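(* Let $n\ge2$ and let $W_n$ be the set of words in the alphabet $\{1,\dots,n\}$. The operators $\tau_{[i,j]}:W_n\to W_n$, $1\le i<j\le n$, satisfy the relations of the cactus group $\mathcal C_n$, namely: (1) $\tau_{[i,j]}^2=I$ for $i<j$; (2) $\tau_{[i,j]}\tau_{[k,l]}=\tau_{[k,l]}\tau_{[i,j]}$ for $i<j<k<l$; (3) $\tau_{[i,l]}\tau_{[j,k]}\tau_{[i,l]}=\tau_{[i+l-k,\,i+l-j]}$ for $i\le j<k\le l$.
   Context: SSYT are semistandard Young tableaux (rows weakly increasing, columns strictly increasing). Bender-Knuth moves: for $i\ge1$, $t_i$ acts on an SSYT as follows. Consider only the boxes with entry $i$ or $i+1$. Each row of this skew tableau consists, from left to right, of $a$ entries $i$ lying directly above an $i+1$, then $b$ entries $i$ alone in their columns, then $c$ entries $i+1$ alone in their columns, then $d$ entries $i+1$ lying directly below an $i$. In every row, replace the $b$ free $i$'s followed by $c$ free $(i+1)$'s by $c$ $i$'s followed by $b$ $(i+1)$'s. All other entries are unchanged. Define the following operators on SSYT (products are compositions, the rightmost factor is applied first): $E_m=t_1(t_2t_1)\cdots(t_{m-1}t_{m-2}\cdots t_1)$ (with $E_0=E_1=I$), which is Sch\"utzenberger involution (evacuation) on the entries $\le m$; and $R_{r,s}=(t_s t_{s-1}\cdots t_1)(t_{s+1}t_s\cdots t_2)\cdots(t_{r+s-1}t_{r+s-2}\cdots t_r)$ (with $R_{0,s}=R_{r,0}=I$), the jeu-de-taquin growth-diagram operator of an $r\times s$ rectangle.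 For an SSYT $S$, $S|_{[p,q]}$ denotes the skew tableau of boxes of $S$ with entries in $[p,q]$, with all entries decreased by $p-1$. Let $\delta_m=(m,m-1,\dots,1)$. For a word $w=w_1\cdots w_m\in W_n$, $T(w)$ is the SSYT of skew shape $\delta_m/\delta_{m-1}$ with $w_1$ in the bottom-left box, $w_2$ in the next box up, and so on. Definition of $\tau_{[i,j]}$ on a word $w\in W_n$ of length $m\geq 1$ (the empty word is fixed): choose any SSYT $S$ of shape $\delta_m$ with entries in $\{1,\dots,m-1+n\}$ and $S|_{[m,m-1+n]}=T(w)$; let $$S'=\big(R_{j-i+1,\,m+i-2}\circ E_{j-i+1}\circ R_{m+i-2,\,j-i+1}\big)(S).$$ Then $S'|_{[m,m-1+n]}=T(w')$ for a word $w'\in W_n$ of length $m$ which does not depend on the choice of $S$, and $\tau_{[i,j]}(w):=w'$. *)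

theory Defs
  imports "HOL-Library.FuncSet"
begin

section \<open>Tableaux\<close>

text \<open>Boxes are pairs (row, column), both counted from 0, in English notation: row 0 is the
  top row. A tableau (straight or skew) is a partial map from boxes to entries, and its domain
  is its set of boxes.\<close>

type_synonym box = "nat \<times> nat"
type_synonym tableau = "box \<rightharpoonup> nat"

definition diagram :: "nat list \<Rightarrow> box set" where
  "diagram lam = {(r, c). r < length lam \<and> c < lam ! r}"

definition staircase :: "nat \<Rightarrow> nat list" where
  "staircase m = rev [1..<Suc m]"

definition ssyt :: "box set \<Rightarrow> tableau \<Rightarrow> bool" where
  "ssyt D T \<longleftrightarrow> dom T = D \<and> (\<forall>x\<in>ran T. 1 \<le> x) \<and>
     (\<forall>r c c' x y. c < c' \<longrightarrow> T (r, c) = Some x \<longrightarrow> T (r, c') = Some y \<longrightarrow> x \<le> y) \<and>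
     (\<forall>r r' c x y. r < r' \<longrightarrow> T (r, c) = Some x \<longrightarrow> T (r', c) = Some y \<longrightarrow> x < y)"

definition restrict_entries :: "nat \<Rightarrow> nat \<Rightarrow> tableau \<Rightarrow> tableau" where
  "restrict_entries p q T = (\<lambda>b. case T b of
       None \<Rightarrow> None
     | Some x \<Rightarrow> if p \<le> x \<and> x \<le> q then Some (x - (p - 1)) else None)"


section \<open>Bender-Knuth moves\<close>

definition free_low :: "nat \<Rightarrow> tableau \<Rightarrow> box \<Rightarrow> bool" where
  "free_low i T = (\<lambda>(r, c). T (r, c) = Some i \<and> T (Suc r, c) \<noteq> Some (Suc i))"

definition free_high :: "nat \<Rightarrow> tableau \<Rightarrow> box \<Rightarrow> bool" where
  "free_high i T = (\<lambda>(r, c). T (r, c) = Some (Suc i) \<and>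
     \<not> (\<exists>r'. r = Suc r' \<and> T (r', c) = Some i))"

text \<open>If a row has \<open>k\<close> free entries \<open>i + 1\<close>, its \<open>k\<close> leftmost free boxes receive \<open>i\<close>
  and its other free boxes receive \<open>i + 1\<close>.\<close>

definition bender_knuth :: "nat \<Rightarrow> tableau \<Rightarrow> tableau" where
  "bender_knuth i T = (\<lambda>(r, c).
     if free_low i T (r, c) \<or> free_high i T (r, c) then
       (if card {c'. c' < c \<and> (free_low i T (r, c') \<or> free_high i T (r, c'))}
             < card {c'. free_high i T (r, c')}
        then Some i else Some (Suc i))
     else T (r, c))"

text \<open>Writing \<open>t i\<close> for \<open>bender_knuth i\<close>, \<open>bk_down b a\<close> is the composition
  \<open>t b \<circ> t (b - 1) \<circ> \<dots> \<circ> t a\<close>. As \<open>foldr f [x, y] T = f x (f y T)\<close>, the last list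
  element is applied first; empty products are the identity.\<close>

definition bk_down :: "nat \<Rightarrow> nat \<Rightarrow> tableau \<Rightarrow> tableau" where
  "bk_down b a = foldr bender_knuth (rev [a..<Suc b])"

definition evac :: "nat \<Rightarrow> tableau \<Rightarrow> tableau" where
  "evac m = foldr (\<lambda>k. bk_down k 1) [1..<m]"

definition rect_op :: "nat \<Rightarrow> nat \<Rightarrow> tableau \<Rightarrow> tableau" where
  "rect_op r s = foldr (\<lambda>k. bk_down (s + k - 1) k) [1..<Suc r]"


section \<open>The operators on words\<close>

definition words :: "nat \<Rightarrow> nat list set" where
  "words n = lists {1..n}"

text \<open>The boxes of the staircase border strip are those with \<open>r + c = m - 1\<close>; the bottom-left
  one, in column 0, carries the first letter.\<close>

definition word_tableau :: "nat list \<Rightarrow> tableau" where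
  "word_tableau w = (\<lambda>(r, c). if r + c + 1 = length w then Some (w ! c) else None)"

lemma dom_word_tableau:
  "dom (word_tableau w) =
     diagram (staircase (length w)) - diagram (staircase (length w - 1))"
proof -
  have "diagram (staircase m) = {(r, c). r + c < m}" for m
    by (auto simp: diagram_def staircase_def rev_nth simp del: upt_Suc)
  then show ?thesis
    by (auto simp: word_tableau_def split: if_splits)
qed

definition lifts :: "nat \<Rightarrow> nat list \<Rightarrow> tableau set" where
  "lifts n w = (let m = length w in
     {S. ssyt (diagram (staircase m)) S \<and> ran S \<subseteq> {1..m - 1 + n} \<and>
         restrict_entries m (m - 1 + n) S = word_tableau w})"

text \<open>The description operator expresses that the resulting word is the same for every choice of
  the lift \<open>S\<close>.\<close>

definition tau :: "nat \<Rightarrow> nat \<Rightarrow> nat \<Rightarrow> nat list \<Rightarrow> nat list" where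
  "tau n i j w = (if w = [] then [] else
     (let m = length w in
      THE w'. w' \<in> words n \<and> length w' = m \<and>
        (\<forall>S\<in>lifts n w.
           restrict_entries m (m - 1 + n)
             ((rect_op (j - i + 1) (m + i - 2) \<circ> evac (j - i + 1) \<circ> rect_op (m + i - 2) (j - i + 1)) S)
           = word_tableau w')))"

end

theory Submission
  imports Defs
begin

text \<open>Record a tableau by its Gelfand-Tsetlin pattern, whose level \<open>k\<close> is the shape of the boxes with
  entries at most \<open>k\<close>. A Bender-Knuth move becomes a toggle of one level that depends only on the two
  neighbouring levels, so toggles are involutions and distant ones commute. This alone gives
  \<open>R r s\<close> inverse to \<open>R s r\<close>, \<open>E m\<close> involutive, and \<open>E (r + s) = E s \<circ> R r s \<circ> E r\<close>.

  The remaining input is that two consecutive toggles intertwine the crystal raising operators of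
  adjacent indices; hence \<open>R b u\<close> carries the crystal structure on the letters \<open>b + 1, \<dots>, b + u\<close> to the
  one on \<open>1, \<dots>, u\<close>. A highest weight tableau of straight shape is determined by its
  weight, so the rectified band depends only on the band itself, and the conjugate
  \<open>R u b \<circ> E u \<circ> R b u\<close> is the unique operation which fixes all other letters and moves the band
  within its crystal component so as to evacuate its rectification. This makes
  \<open>tau\<close> independent of the lift, makes disjoint bands commute, and lets \<open>R\<close> transport one
  band operator to another, which reduces the last cactus relation to \<open>E (r + s) = E s \<circ> R r s \<circ> E r\<close>.\<close>

section \<open>Gelfand-Tsetlin patterns and toggles\<close>

text \<open>Level \<open>k\<close>, row \<open>q\<close> holds the length of row \<open>q\<close> of
  the shape formed by the entries at most \<open>k\<close>. Integers keep reflections and excesses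
  free of truncated subtraction.\<close>

type_synonym pattern = "nat \<Rightarrow> nat \<Rightarrow> int"

definition gt_pattern :: "pattern \<Rightarrow> bool" where
  "gt_pattern x \<longleftrightarrow> x 0 = (\<lambda>_. 0) \<and>
     (\<forall>k q. x k q \<le> x (Suc k) q \<and> x (Suc k) (Suc q) \<le> x k q)"

text \<open>Together with \<open>lower\<close>, the ends of the interval that interlacing with
  levels \<open>i - 1\<close> and \<open>i + 1\<close> leaves for \<open>x i q\<close>; row 0 has no
  row above it to bound it. A toggle reflects the entry in this interval.\<close>

definition upper :: "nat \<Rightarrow> pattern \<Rightarrow> nat \<Rightarrow> int" where
  "upper i x q = (case q of 0 \<Rightarrow> x (Suc i) 0 | Suc p \<Rightarrow> min (x (Suc i) (Suc p)) (x (i - 1) p))"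

definition lower :: "nat \<Rightarrow> pattern \<Rightarrow> nat \<Rightarrow> int" where
  "lower i x q = max (x (Suc i) (Suc q)) (x (i - 1) q)"

definition toggle :: "nat \<Rightarrow> pattern \<Rightarrow> pattern" where
  "toggle i x = x(i := \<lambda>q. upper i x q + lower i x q - x i q)"

lemma toggle_other [simp]: "k \<noteq> i \<Longrightarrow> toggle i x k = x k"
  by (simp add: toggle_def)

lemma toggle_same: "toggle i x i q = upper i x q + lower i x q - x i q"
  by (simp add: toggle_def)

lemma toggle_cong:
  "x (Suc i) = y (Suc i) \<Longrightarrow> x (i - 1) = y (i - 1) \<Longrightarrow> x i = y i \<Longrightarrow> toggle i x i = toggle i y i"
  by (simp add: toggle_def upper_def[abs_def] lower_def[abs_def])

text \<open>The interval depends on levels \<open>i - 1\<close> and \<open>i + 1\<close> alone, and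
  both differ from \<open>i\<close> since \<open>i\<close> is positive. Hence both reflections use
  the same interval.\<close>

lemma toggle_toggle [simp]:
  assumes "1 \<le> i" shows "toggle i (toggle i x) = x"
proof -
  have "upper i (toggle i x) = upper i x" "lower i (toggle i x) = lower i x"
    using assms by (auto simp: upper_def lower_def toggle_def fun_eq_iff split: nat.split)
  then show ?thesis by (simp add: toggle_def[of i "toggle i x"] toggle_same) (simp add: toggle_def)
qed

lemma toggle_commute:
  assumes "i + 2 \<le> j" shows "toggle i (toggle j x) = toggle j (toggle i x)"
proof
  fix k
  show "toggle i (toggle j x) k = toggle j (toggle i x) k"
  proof (cases "k = i")
    case True
    then show ?thesis using assms by (simp, intro toggle_cong) auto
  next
    case False
    then show ?thesis
      using assms toggle_cong[of x j "toggle i x"] by (cases "k = j") auto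
  qed
qed

lemma foldr_toggle_commute1:
  assumes "\<forall>j\<in>set js. i + 2 \<le> j \<or> j + 2 \<le> i"
  shows "toggle i (foldr toggle js x) = foldr toggle js (toggle i x)"
  using assms
proof (induction js)
  case (Cons j js)
  then have "toggle i (toggle j y) = toggle j (toggle i y)" for y
    using toggle_commute[of i j] toggle_commute[of j i] by fastforce
  then show ?case using Cons by simp
qed simp

lemma foldr_toggle_commute:
  assumes "\<forall>i\<in>set is. \<forall>j\<in>set js. i + 2 \<le> j \<or> j + 2 \<le> i"
  shows "foldr toggle is (foldr toggle js x) = foldr toggle js (foldr toggle is x)"
  using assms by (induction "is") (auto simp: foldr_toggle_commute1)

lemma foldr_toggle_other: "k \<notin> set is \<Longrightarrow> foldr toggle is x k = x k"
  by (induction "is") auto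

lemma foldr_toggle_cancel:
  "0 \<notin> set is \<Longrightarrow> foldr toggle (rev is) (foldr toggle is x) = x"
  by (induction "is") auto

definition agree :: "nat set \<Rightarrow> pattern \<Rightarrow> pattern \<Rightarrow> bool" where
  "agree A x y \<longleftrightarrow> (\<forall>k\<in>A. x k = y k)"

text \<open>Level \<open>u\<close> is read but never changed by toggles with indices
  \<open>1, ..., u - 1\<close>, so no information enters from above it.\<close>

lemma foldr_toggle_agree:
  assumes "agree {0..u} x y" "set is \<subseteq> {1..<u}"
  shows "agree {0..u} (foldr toggle is x) (foldr toggle is y)"
  using assms(2)
proof (induction "is")
  case (Cons i "is")
  then have IH: "agree {0..u} (foldr toggle is x) (foldr toggle is y)" by simp
  show ?case unfolding agree_def
  proof
    fix k assume "k \<in> {0..u}"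
    then show "foldr toggle (i # is) x k = foldr toggle (i # is) y k"
      using IH Cons.prems by (cases "k = i") (auto simp: agree_def intro: toggle_cong)
  qed
qed (use assms in simp)

section \<open>Evacuation and rectangle operators as words of indices\<close>

definition down_word :: "nat \<Rightarrow> nat \<Rightarrow> nat list" where
  "down_word b a = rev [a..<Suc b]"

definition evac_word :: "nat \<Rightarrow> nat list" where
  "evac_word m = concat (map (\<lambda>k. down_word k 1) [1..<m])"

definition rect_word :: "nat \<Rightarrow> nat \<Rightarrow> nat list" where
  "rect_word r s = concat (map (\<lambda>k. down_word (s + k - 1) k) [1..<Suc r])"

text \<open>Folding one index list with \<open>toggle\<close> or with \<open>bender_knuth\<close>
  gives corresponding operators on patterns and on tableaux, so identities between lists serve
  both.\<close>

abbreviation pdown where "pdown b a \<equiv> foldr toggle (down_word b a)"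
abbreviation pevac where "pevac m \<equiv> foldr toggle (evac_word m)"
abbreviation prect where "prect r s \<equiv> foldr toggle (rect_word r s)"

lemma set_down_word [simp]: "set (down_word b a) = {a..b}"
  by (auto simp: down_word_def)

lemma set_evac_word: "set (evac_word m) = {1..<m}"
  by (auto simp: evac_word_def)

lemma set_rect_word: "set (rect_word r s) \<subseteq> {1..<r + s}"
  by (auto simp: rect_word_def)

lemma foldr_concat_map: "foldr (\<lambda>k. foldr f (g k)) ks = foldr f (concat (map g ks))"
  by (induction ks) (auto simp: fun_eq_iff)

lemma down_word_Suc: "a \<le> Suc b \<Longrightarrow> down_word (Suc b) a = Suc b # down_word b a"
  by (simp add: down_word_def)

lemma down_word_empty [simp]: "b < a \<Longrightarrow> down_word b a = []"
  by (simp add: down_word_def)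

lemma down_word_split:
  assumes "a \<le> Suc k" "k \<le> b"
  shows "down_word b a = down_word b (Suc k) @ down_word k a"
proof -
  have "[a..<Suc b] = [a..<Suc k] @ [Suc k..<Suc b]"
    using upt_add_eq_append[of a "Suc k" "b - k"] assms by simp
  then show ?thesis by (simp add: down_word_def)
qed

lemma evac_word_Suc: "1 \<le> m \<Longrightarrow> evac_word (Suc m) = evac_word m @ down_word m 1"
  by (simp add: evac_word_def)

lemma rect_word_Suc: "rect_word (Suc r) s = rect_word r s @ down_word (s + r) (Suc r)"
  by (simp add: rect_word_def)

lemma rect_word_0 [simp]: "rect_word 0 s = []" "rect_word r 0 = []"
  by (auto simp: rect_word_def)

lemma evac_word_0 [simp]: "evac_word 0 = []" "evac_word (Suc 0) = []"
  by (auto simp: evac_word_def)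

text \<open>The definition grows a rectangle in \<open>r\<close>; this recursion grows it in
  \<open>s\<close>. The leading factor of each descending run is far from all indices of the smaller
  rectangle, so it can be pulled out to the left, and these factors form an ascending run.\<close>

lemma prect_Suc_right:
  "prect r (Suc s) x = foldr toggle [Suc s..<Suc (s + r)] (prect r s x)"
proof (induction r arbitrary: x)
  case (Suc r)
  have "prect (Suc r) (Suc s) x = prect r (Suc s) (toggle (Suc (s + r)) (pdown (s + r) (Suc r) x))"
    by (simp add: rect_word_Suc down_word_Suc)
  also have "\<dots> = foldr toggle [Suc s..<Suc (s + r)]
      (prect r s (toggle (Suc (s + r)) (pdown (s + r) (Suc r) x)))"
    by (rule Suc.IH)
  also have "prect r s (toggle (Suc (s + r)) (pdown (s + r) (Suc r) x)) =
      toggle (Suc (s + r)) (prect r s (pdown (s + r) (Suc r) x))"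
    using set_rect_word[of r s] by (intro foldr_toggle_commute1[symmetric]) fastforce
  finally show ?case by (simp add: rect_word_Suc)
qed simp

text \<open>Expanding one factor in its first argument and the other in its second produces two runs
  that are reverses of each other, with a smaller instance between them.\<close>

lemma prect_prect [simp]: "prect s r (prect r s x) = x"
proof (induction r arbitrary: x)
  case (Suc r)
  let ?y = "pdown (s + r) (Suc r) x"
  have "prect s (Suc r) (prect (Suc r) s x) =
      foldr toggle [Suc r..<Suc (r + s)] (prect s r (prect r s ?y))"
    by (simp add: rect_word_Suc prect_Suc_right)
  also have "\<dots> = foldr toggle (rev (down_word (s + r) (Suc r))) ?y"
    by (simp add: Suc.IH down_word_def add.commute)
  also have "\<dots> = x" by (rule foldr_toggle_cancel) simp
  finally show ?case .
qed simp

lemma prect_inject: "prect r s x = prect r s y \<longleftrightarrow> x = y"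
  by (metis prect_prect)

text \<open>Induction on \<open>r\<close>: the last run of the evacuation is cut after index
  \<open>r\<close>. Its upper piece commutes with \<open>pevac r\<close> and completes the
  rectangle; its lower piece completes \<open>pevac (Suc r)\<close>.\<close>

lemma pevac_add: "pevac (r + s) x = pevac s (prect r s (pevac r x))"
proof (induction r arbitrary: x)
  case (Suc r)
  show ?case
  proof (cases "r = 0")
    case True
    then show ?thesis using rect_word_Suc[of 0 s] evac_word_Suc[of s]
      by (cases "s = 0") auto
  next
    case False
    have "pevac (Suc r + s) x = pevac (r + s) (pdown (r + s) 1 x)"
      using False by (simp add: evac_word_Suc)
    also have "\<dots> = pevac s (prect r s (pevac r (pdown (s + r) (Suc r) (pdown r 1 x))))"
      using down_word_split[of 1 r "s + r"] by (simp add: Suc.IH add.commute)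
    also have "pevac r (pdown (s + r) (Suc r) (pdown r 1 x)) =
        pdown (s + r) (Suc r) (pevac r (pdown r 1 x))"
      by (rule foldr_toggle_commute) (auto simp: set_evac_word)
    finally show ?thesis using False by (simp add: evac_word_Suc rect_word_Suc)
  qed
qed simp

text \<open>The splittings \<open>1 + m\<close> and \<open>m + 1\<close> present
  \<open>pevac (Suc m)\<close> as \<open>pevac m\<close> after \<open>prect 1 m\<close> and as
  \<open>prect m 1\<close> after \<open>pevac m\<close>. In the square the inner factors cancel by
  induction, the outer ones by \<open>prect_prect\<close>.\<close>

lemma pevac_pevac [simp]: "pevac m (pevac m x) = x"
proof (induction m arbitrary: x)
  case (Suc m)
  have "pevac (Suc m) (pevac (Suc m) x) = prect m 1 (pevac m (pevac m (prect 1 m x)))"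
    using pevac_add[of 1 m x] pevac_add[of m 1 "pevac (Suc m) x"] by simp
  then show ?case by (simp add: Suc.IH)
qed simp

section \<open>Interlacing inequalities\<close>

lemma gt_patternD:
  assumes "gt_pattern x"
  shows "x 0 q = 0" "x k q \<le> x (Suc k) q" "x (Suc k) (Suc q) \<le> x k q"
  using assms by (auto simp: gt_pattern_def)

lemma gt_pattern_mono:
  assumes "gt_pattern x" "j \<le> k" shows "x j q \<le> x k q"
  using assms(2) by (rule lift_Suc_mono_le[rotated]) (rule gt_patternD[OF assms(1)])

lemma gt_pattern_nonneg: "gt_pattern x \<Longrightarrow> 0 \<le> x k q"
  using gt_pattern_mono[of x 0 k q] gt_patternD(1)[of x q] by simp

lemma gt_pattern_eq_0:
  assumes "gt_pattern x" "k \<le> q" shows "x k q = 0"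
  using assms(2)
proof (induction k arbitrary: q)
  case (Suc k)
  then obtain p where "q = Suc p" "k \<le> p" by (cases q) auto
  then show ?case
    using Suc.IH gt_patternD(3)[OF assms(1), of k p] gt_pattern_nonneg[OF assms(1), of "Suc k" q]
    by fastforce
qed (simp add: gt_patternD(1)[OF assms(1)])

lemma gt_pattern_bounds:
  assumes "gt_pattern x" "1 \<le> i"
  shows "lower i x q \<le> x i q" "x i q \<le> upper i x q"
proof -
  obtain j where i: "i = Suc j" using assms(2) by (cases i) auto
  show "lower i x q \<le> x i q"
    using gt_patternD[OF assms(1)] by (auto simp: i lower_def)
  show "x i q \<le> upper i x q"
    using gt_patternD[OF assms(1)] by (auto simp: i upper_def split: nat.split)
qed

lemma gt_pattern_toggle:
  assumes x: "gt_pattern x" and "1 \<le> i" shows "gt_pattern (toggle i x)"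
proof -
  obtain j where i: "i = Suc j" using assms(2) by (cases i) auto
  have lo: "lower i x q \<le> toggle i x i q" and up: "toggle i x i q \<le> upper i x q" for q
    using gt_pattern_bounds[OF assms, of q] by (auto simp: toggle_same)
  have "x j q \<le> toggle i x i q" "x (Suc i) (Suc q) \<le> toggle i x i q" for q
    using lo[of q] by (auto simp: i lower_def)
  moreover have "toggle i x i (Suc q) \<le> x j q" for q
    using up[of "Suc q"] by (auto simp: i upper_def)
  moreover have "toggle i x i q \<le> x (Suc i) q" for q
    using up[of q] by (auto simp: upper_def split: nat.splits)
  moreover have "toggle i x k = x k" if "k \<noteq> i" for k using that by simp
  ultimately have "toggle i x k q \<le> toggle i x (Suc k) q \<and> toggle i x (Suc k) (Suc q) \<le> toggle i x k q"
    for k q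
    using gt_patternD(2,3)[OF x, of k q] i by (cases "k = i"; cases "k = j") auto
  moreover have "toggle i x 0 = (\<lambda>_. 0)"
    using gt_patternD(1)[OF x] i by auto
  ultimately show ?thesis by (simp add: gt_pattern_def)
qed

lemma gt_pattern_foldr_toggle:
  "gt_pattern x \<Longrightarrow> 0 \<notin> set is \<Longrightarrow> gt_pattern (foldr toggle is x)"
  by (induction "is") (auto intro: gt_pattern_toggle)

lemma gt_pattern_prect: "gt_pattern x \<Longrightarrow> gt_pattern (prect r s x)"
  using set_rect_word[of r s] by (intro gt_pattern_foldr_toggle) auto

lemma gt_pattern_pevac: "gt_pattern x \<Longrightarrow> gt_pattern (pevac m x)"
  by (intro gt_pattern_foldr_toggle) (auto simp: set_evac_word)

section \<open>Weights under toggles\<close>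

text \<open>The \<open>max\<close> in \<open>lower\<close> at row \<open>q\<close> and the
  \<open>min\<close> in \<open>upper\<close> at row \<open>q + 1\<close> have the same two arguments
  and add up to their sum; only the last \<open>max\<close> is left unpaired.\<close>

lemma sum_upper_lower:
  "(\<Sum>q\<le>r. upper i x q + lower i x q) =
     (\<Sum>q\<le>r. x (Suc i) q) + (\<Sum>q<r. x (i - 1) q) + max (x (Suc i) (Suc r)) (x (i - 1) r)"
  by (induction r) (auto simp: upper_def lower_def max_def min_def)

text \<open>For a pattern and \<open>k\<close> at most \<open>N + 1\<close> this is the number of
  entries at most \<open>k\<close>, because level \<open>k\<close> has at most \<open>k\<close>
  nonzero rows. Differences of consecutive levels give the weight.\<close>

definition level_sum :: "nat \<Rightarrow> nat \<Rightarrow> pattern \<Rightarrow> int" where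
  "level_sum N k x = (\<Sum>q\<le>N. x k q)"

lemma level_sum_toggle:
  assumes "gt_pattern x" "1 \<le> i" "i \<le> N"
  shows "level_sum N i (toggle i x) = level_sum N (Suc i) x + level_sum N (i - 1) x - level_sum N i x"
proof -
  have "x (Suc i) (Suc N) = 0" "x (i - 1) N = 0"
    using assms by (auto intro: gt_pattern_eq_0)
  moreover have "(\<Sum>q\<le>N. x (i - 1) q) = (\<Sum>q<N. x (i - 1) q) + x (i - 1) N"
    by (simp flip: lessThan_Suc_atMost)
  ultimately show ?thesis
    using sum_upper_lower[of i x N]
    by (simp add: level_sum_def toggle_same sum_subtractf)
qed

text \<open>Each toggle exchanges the multiplicities of two adjacent letters, so the run carries the
  multiplicity of \<open>a\<close> up to \<open>b + 1\<close> and shifts the others down by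
  one.\<close>

lemma level_sum_pdown:
  assumes "gt_pattern x" "1 \<le> a" "b \<le> N" "a \<le> k" "k \<le> b"
  shows "level_sum N k (pdown b a x) =
    level_sum N (Suc k) x - level_sum N a x + level_sum N (a - 1) x"
  using assms(3-5)
proof (induction b arbitrary: k)
  case (Suc b)
  let ?y = "pdown b a x"
  have y: "gt_pattern ?y" using assms(1,2) by (intro gt_pattern_foldr_toggle) auto
  have eq: "pdown (Suc b) a x = toggle (Suc b) ?y"
    using Suc.prems by (simp add: down_word_Suc)
  have out: "level_sum N j ?y = level_sum N j x" if "j < a \<or> b < j" for j
    using that by (auto simp: level_sum_def foldr_toggle_other)
  show ?case
  proof (cases "k = Suc b")
    case True
    have "level_sum N b ?y = level_sum N (Suc b) x - level_sum N a x + level_sum N (a - 1) x"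
    proof (cases "a \<le> b")
      case True then show ?thesis using Suc by simp
    next
      case False
      then have "a = Suc b" using Suc.prems by simp
      then show ?thesis using out[of b] by simp
    qed
    then show ?thesis
      using level_sum_toggle[OF y, of "Suc b" N] out Suc.prems eq True by simp
  next
    case False
    then have "level_sum N k (pdown (Suc b) a x) = level_sum N k ?y"
      by (simp add: eq level_sum_def)
    then show ?thesis using Suc False by simp
  qed
qed (use assms in simp)

lemma level_sum_prect:
  assumes "gt_pattern x" "r + s \<le> N" "k \<le> s"
  shows "level_sum N k (prect r s x) = level_sum N (r + k) x - level_sum N r x"
  using assms(1,2)
proof (induction r arbitrary: x)
  case 0
  then show ?case by (simp add: level_sum_def gt_patternD(1))
next
  case (Suc r)
  let ?y = "pdown (s + r) (Suc r) x"
  have "gt_pattern ?y" using Suc.prems by (intro gt_pattern_foldr_toggle) auto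
  then have "level_sum N k (prect (Suc r) s x) = level_sum N (r + k) ?y - level_sum N r ?y"
    using Suc by (simp add: rect_word_Suc)
  also have "level_sum N r ?y = level_sum N r x"
    by (simp add: level_sum_def foldr_toggle_other)
  also have "level_sum N (r + k) ?y =
    (if k = 0 then level_sum N r x
     else level_sum N (Suc (r + k)) x - level_sum N (Suc r) x + level_sum N r x)"
    using level_sum_pdown[OF Suc.prems(1), of "Suc r" "s + r" N "r + k"] Suc.prems assms(3)
    by (auto simp: level_sum_def foldr_toggle_other)
  finally show ?case by (auto split: if_splits)
qed

section \<open>Crystal raising operators\<close>

text \<open>For the pattern of a tableau, \<open>excess k x r\<close> counts the letters \<open>k + 1\<close> in rows \<open>0, \<dots>, r\<close> minus
  the letters \<open>k\<close> in rows \<open>0, \<dots>, r - 1\<close>. By the signature rule, the raising operator acts in the first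
  row that attains the maximum, provided that the maximum is positive.\<close>

definition excess :: "nat \<Rightarrow> pattern \<Rightarrow> nat \<Rightarrow> int" where
  "excess k x r = (\<Sum>q\<le>r. x (Suc k) q - x k q) - (\<Sum>q<r. x k q - x (k - 1) q)"

text \<open>Changing one letter \<open>k + 1\<close> of row \<open>r\<close> into \<open>k\<close>
  lengthens that row at level \<open>k\<close> and affects no other level.\<close>

definition bump :: "nat \<Rightarrow> nat \<Rightarrow> pattern \<Rightarrow> pattern" where
  "bump k r x = x(k := (x k)(r := x k r + 1))"

definition top_argmax :: "(nat \<Rightarrow> int) \<Rightarrow> nat \<Rightarrow> bool" where
  "top_argmax f r \<longleftrightarrow> (\<forall>q<r. f q < f r) \<and> (\<forall>q. f q \<le> f r)"

definition raises :: "nat \<Rightarrow> pattern \<Rightarrow> pattern \<Rightarrow> bool" where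
  "raises k x y \<longleftrightarrow> (\<exists>r. top_argmax (excess k x) r \<and> 0 < excess k x r \<and> y = bump k r x)"

definition highest :: "nat \<Rightarrow> pattern \<Rightarrow> bool" where
  "highest k x \<longleftrightarrow> (\<forall>r. excess k x r \<le> 0)"

lemma top_argmax_unique: "top_argmax f r \<Longrightarrow> top_argmax f r' \<Longrightarrow> r = r'"
  unfolding top_argmax_def by (meson leD linorder_neqE_nat)

lemma excess_0: "excess k x 0 = x (Suc k) 0 - x k 0"
  by (simp add: excess_def)

lemma excess_Suc:
  "excess k x (Suc r) = excess k x r + (x (Suc k) (Suc r) - x k (Suc r)) - (x k r - x (k - 1) r)"
  by (simp add: excess_def)

lemma excess_cong:
  "x (Suc k) = y (Suc k) \<Longrightarrow> x k = y k \<Longrightarrow> x (k - 1) = y (k - 1) \<Longrightarrow> excess k x = excess k y"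
  by (simp add: excess_def[abs_def])

lemma excess_bump:
  assumes "1 \<le> k"
  shows "excess k (bump k r x) q =
    (if q < r then excess k x q else if q = r then excess k x q - 1 else excess k x q - 2)"
  using assms by (induction q) (auto simp: excess_0 excess_Suc bump_def)

text \<open>On a pattern, \<open>overhang k x r\<close> counts the columns with \<open>k\<close> in
  row \<open>r - 1\<close> directly above \<open>k + 1\<close> in row \<open>r\<close>. The
  \<open>clearance\<close> counts the entries below \<open>k\<close> in row \<open>r\<close> that
  have no entry at most \<open>k + 1\<close> directly below them. They measure which argument wins
  in the \<open>max\<close> and \<open>min\<close> of toggle \<open>k\<close>.\<close>

definition overhang :: "nat \<Rightarrow> pattern \<Rightarrow> nat \<Rightarrow> int" where
  "overhang k x r = (case r of 0 \<Rightarrow> 0 | Suc p \<Rightarrow> max 0 (x (Suc k) r - x (k - 1) p))"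

definition clearance :: "nat \<Rightarrow> pattern \<Rightarrow> nat \<Rightarrow> int" where
  "clearance k x r = max 0 (x (k - 1) r - x (Suc k) (Suc r))"

text \<open>The sign of this gap decides the \<open>max\<close> and \<open>min\<close> in the
  following toggle of level \<open>Suc k\<close>; in this form it is governed by the excess.\<close>

lemma toggle_gap:
  "x (Suc (Suc k)) (Suc r) - toggle k x k r =
     excess (Suc k) x (Suc r) - excess (Suc k) x r + overhang k x r - clearance k x r"
  by (auto simp: excess_Suc toggle_same overhang_def clearance_def upper_def lower_def split: nat.split)

text \<open>At most one of \<open>overhang k x (Suc r)\<close> and \<open>clearance k x r\<close> is nonzero, so the two toggles
  preserve the maximal excess and move the row attaining it by at most one.\<close>

lemma excess_toggle_toggle:
  fixes x :: pattern
  assumes "1 \<le> k"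
  defines "y \<equiv> toggle (Suc k) (toggle k x)"
  shows "excess k y r = max (excess (Suc k) x r - overhang k x r) (excess (Suc k) x (Suc r) - clearance k x r)"
proof -
  have yk: "y k = toggle k x k" and out: "y (k - 1) = x (k - 1)"
      and k2: "y (Suc (Suc k)) = x (Suc (Suc k))"
    using assms by (auto simp: y_def)
  have yk': "y (Suc k) q = upper (Suc k) y q + lower (Suc k) y q - x (Suc k) q" for q
    using assms by (auto simp: y_def toggle_same upper_def lower_def split: nat.split)
  have max_diff: "max a b = b + max 0 (a - b)" for a b :: int by simp
  define M where "M = max 0 (x (Suc (Suc k)) (Suc r) - y k r)"
  define L where "L f = (\<Sum>q<r. f q)" for f :: "nat \<Rightarrow> int"
  have at: "(\<Sum>q\<le>r. f q) = L f + f r" for f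
    by (simp add: L_def flip: lessThan_Suc_atMost)
  \<comment> \<open>In the telescoped sum for level \<open>k\<close> only the last
    \<open>max\<close> remains; \<open>overhang\<close> is its surplus over level
    \<open>k - 1\<close>.\<close>
  have s1: "L (y k) + L (x k) = L (x (Suc k)) + L (x (k - 1)) + overhang k x r"
  proof (cases r)
    case 0
    then show ?thesis by (simp add: L_def overhang_def)
  next
    case (Suc p)
    have L: "L f = (\<Sum>q\<le>p. f q)" for f by (simp add: L_def Suc lessThan_Suc_atMost)
    have L': "L f = (\<Sum>q<p. f q) + f p" for f by (simp add: L_def Suc)
    have "L (y k) + L (x k) = L (x (Suc k)) + (\<Sum>q<p. x (k - 1) q)
        + max (x (Suc k) (Suc p)) (x (k - 1) p)"
      using sum_upper_lower[of k x p] by (simp add: yk L toggle_same sum_subtractf)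
    then show ?thesis
      unfolding max_diff[of "x (Suc k) (Suc p)"] by (simp add: L' overhang_def Suc)
  qed
  \<comment> \<open>The same count for level \<open>Suc k\<close>, whose toggle sees the already
    toggled level \<open>k\<close>. Its surplus \<open>M\<close> becomes a difference of excesses
    through \<open>toggle_gap\<close>.\<close>
  have s2: "L (y (Suc k)) + y (Suc k) r + L (x (Suc k)) + x (Suc k) r =
      L (x (Suc (Suc k))) + x (Suc (Suc k)) r + L (y k) + y k r + M"
  proof -
    have "(\<Sum>q\<le>r. y (Suc k) q) + (\<Sum>q\<le>r. x (Suc k) q) = (\<Sum>q\<le>r. x (Suc (Suc k)) q) + L (y k)
        + max (x (Suc (Suc k)) (Suc r)) (y k r)"
      using sum_upper_lower[of "Suc k" y r] by (simp add: yk' k2 L_def sum_subtractf)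
    then show ?thesis unfolding max_diff[of "x (Suc (Suc k)) (Suc r)"] at M_def by simp
  qed
  have e: "excess j z r = L (z (Suc j)) + z (Suc j) r - L (z j) - z j r - L (z j) + L (z (j - 1))" for j z
    by (simp add: excess_def sum_subtractf at flip: L_def)
  have "excess k y r = excess (Suc k) x r + M - overhang k x r"
    using s1 s2 out by (simp add: e)
  moreover have "M = max 0 (excess (Suc k) x (Suc r) - excess (Suc k) x r + overhang k x r - clearance k x r)"
    by (simp only: M_def yk toggle_gap)
  ultimately show ?thesis by (simp add: max_def)
qed

lemma highest_toggle_toggle:
  assumes "1 \<le> k" "highest (Suc k) x"
  shows "highest k (toggle (Suc k) (toggle k x))"
  unfolding highest_def
proof
  fix r
  have "0 \<le> overhang k x r" "0 \<le> clearance k x r" by (auto simp: overhang_def clearance_def split: nat.split)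
  then show "excess k (toggle (Suc k) (toggle k x)) r \<le> 0"
    using assms by (simp add: excess_toggle_toggle highest_def) (meson order_trans diff_left_mono diff_0_right)
qed

text \<open>Raising \<open>x (Suc k) r\<close> changes exactly one bound: \<open>upper\<close> in
  row \<open>r\<close> if this entry is strictly below \<open>x (k - 1) (r - 1)\<close>, and
  otherwise \<open>lower\<close> in row \<open>r - 1\<close>. For \<open>r = 0\<close> it is
  \<open>upper\<close>.\<close>

lemma toggle_bump:
  fixes x :: pattern
  assumes "1 \<le> k"
  defines "r' \<equiv> \<lambda>r. case r of 0 \<Rightarrow> 0 | Suc p \<Rightarrow> if x (k - 1) p \<le> x (Suc k) r then p else r"
  shows "toggle k (bump (Suc k) r x) k = (toggle k x k)(r' r := toggle k x k (r' r) + 1)"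
  using assms(1)
  by (auto simp: fun_eq_iff toggle_same bump_def r'_def upper_def lower_def split: nat.split)

text \<open>The first toggle passes the added box to level \<open>k\<close> in row \<open>s\<close>,
  and the second absorbs it at level \<open>Suc k\<close>. That \<open>s\<close> is the row in which
  the signature rule acts follows from \<open>excess_toggle_toggle\<close>, which bounds the new
  excess by the old maximum.\<close>

lemma raises_toggle_toggle:
  assumes k: "1 \<le> k" and "raises (Suc k) x y"
  shows "raises k (toggle (Suc k) (toggle k x)) (toggle (Suc k) (toggle k y))"
proof -
  define S where "S = excess (Suc k) x"
  define w where "w = toggle k x"
  define z where "z = toggle (Suc k) w"
  obtain r where r: "top_argmax S r" "0 < S r" and y: "y = bump (Suc k) r x"
    using assms(2) by (auto simp: raises_def S_def)
  define s where "s = (case r of 0 \<Rightarrow> 0 | Suc p \<Rightarrow> if x (k - 1) p \<le> x (Suc k) r then p else r)"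
  have le: "S q \<le> S r" and less: "q < r \<Longrightarrow> S q < S r" for q
    using r unfolding top_argmax_def by blast+
  have ex: "excess k z q = max (S q - overhang k x q) (S (Suc q) - clearance k x q)" for q
    using excess_toggle_toggle[OF k] by (simp add: z_def w_def S_def)
  have nn: "0 \<le> overhang k x q" "0 \<le> clearance k x q" for q
    by (auto simp: overhang_def clearance_def split: nat.split)
  have gap: "x (Suc (Suc k)) (Suc q) - w k q = S (Suc q) - S q + overhang k x q - clearance k x q" for q
    by (simp add: toggle_gap S_def w_def)
  have leS: "excess k z q \<le> S r" for q
    using le[of q] le[of "Suc q"] nn[of q] by (simp add: ex)
  define v where "v = toggle k y"
  have v: "v k = (w k)(s := w k s + 1)" "v (Suc k) = (x (Suc k))(r := x (Suc k) r + 1)"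
      "v (Suc (Suc k)) = x (Suc (Suc k))"
    unfolding v_def w_def s_def y by (rule toggle_bump[OF k]) (simp_all add: bump_def fun_eq_iff)
  have w: "w (Suc k) = x (Suc k)" "w (Suc (Suc k)) = x (Suc (Suc k))"
    by (simp_all add: w_def)
  \<comment> \<open>The box stays in row \<open>r\<close> or moves up one row; the comparison that
    decides this also tells which of the two corrections vanishes.\<close>
  consider (stay) "s = r" "overhang k x r = 0" "\<And>p. r = Suc p \<Longrightarrow> 0 < clearance k x p"
    | (up) p where "r = Suc p" "s = p" "clearance k x p = 0"
    by (cases r; cases "x (k - 1) (r - 1) \<le> x (Suc k) r") (auto simp: s_def overhang_def clearance_def)
  then have *: "excess k z s = S r \<and> (\<forall>q<s. excess k z q < S r) \<and>
      toggle (Suc k) v (Suc k) = z (Suc k)"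
  proof cases
    case stay
    have "excess k z q < S r" if "q < r" for q
      using less[OF that] nn[of q] stay(3)[of q] le[of "Suc q"] less[of "Suc q"] that
      by (cases "Suc q = r") (auto simp: ex)
    moreover have "excess k z r = S r"
      using leS[of r] stay by (simp add: ex)
    \<comment> \<open>Hence \<open>lower\<close> in row \<open>r\<close> grows along with
      \<open>w k r\<close> and cancels the box added at level \<open>Suc k\<close>, while
      \<open>upper\<close> in row \<open>Suc r\<close> is held by level
      \<open>k + 2\<close>.\<close>
    moreover have "x (Suc (Suc k)) (Suc r) \<le> w k r"
      using gap[of r] stay le[of "Suc r"] nn[of r] by simp
    then have "toggle (Suc k) v (Suc k) q = z (Suc k) q" for q
      by (auto simp: toggle_same z_def upper_def lower_def v w stay(1) split: nat.split)
    ultimately show ?thesis using stay by auto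
  next
    case up
    have "excess k z q < S r" if "q < p" for q
      using less[of q] less[of "Suc q"] that nn[of q] up by (auto simp: ex)
    moreover have "excess k z p = S r"
      using leS[of p] up by (simp add: ex)
    \<comment> \<open>Now \<open>upper\<close> in row \<open>r\<close> grows and cancels the added
      box, while \<open>lower\<close> in row \<open>p\<close> is held by level
      \<open>k + 2\<close>.\<close>
    moreover have "w k p < x (Suc (Suc k)) r"
      using gap[of p] up less[of p] nn[of p] by simp
    then have "toggle (Suc k) v (Suc k) q = z (Suc k) q" for q
      by (auto simp: toggle_same z_def upper_def lower_def v w up(1,2) split: nat.split)
    ultimately show ?thesis using up by auto
  qed
  have "toggle (Suc k) v j = bump k s z j" for j
  proof -
    consider "j = Suc k" | "j = k" | "j \<noteq> k" "j \<noteq> Suc k" by blast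
    then show ?thesis
    proof cases
      case 1
      then show ?thesis using * by (simp add: bump_def)
    next
      case 2
      then show ?thesis by (simp add: bump_def z_def v fun_eq_iff)
    next
      case 3
      then show ?thesis by (simp add: bump_def z_def v_def w_def y)
    qed
  qed
  then have "toggle (Suc k) v = bump k s z" by blast
  moreover have "top_argmax (excess k z) s"
    using * leS by (auto simp: top_argmax_def)
  ultimately show ?thesis
    using * r by (auto simp: raises_def z_def v_def w_def)
qed

section \<open>Locality, injectivity and existence of raising moves\<close>

lemma raises_other: "raises k x y \<Longrightarrow> j \<noteq> k \<Longrightarrow> y j = x j"
  by (auto simp: raises_def bump_def)

lemma raises_unique: "raises k x y \<Longrightarrow> raises k x y' \<Longrightarrow> y = y'"
  using top_argmax_unique by (auto simp: raises_def)

lemma raises_agree: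
  assumes "1 \<le> k" "raises k x y" "agree A x x2" "{k - 1, k, Suc k} \<subseteq> A"
  shows "\<exists>y2. raises k x2 y2 \<and> agree A y y2"
proof -
  obtain r where r: "top_argmax (excess k x) r" "0 < excess k x r" and y: "y = bump k r x"
    using assms(2) by (auto simp: raises_def)
  moreover have "excess k x = excess k x2"
    using assms(3,4) by (intro excess_cong) (auto simp: agree_def)
  ultimately have "raises k x2 (bump k r x2)" by (auto simp: raises_def)
  moreover have "agree A y (bump k r x2)"
    using assms(3,4) by (auto simp: agree_def y bump_def)
  ultimately show ?thesis by blast
qed

text \<open>After raising, \<open>r\<close> is the last row attaining the maximal excess. The result
  therefore reveals where the box was added, which makes raising injective.\<close>

lemma excess_bump_max:
  assumes "1 \<le> k" "top_argmax (excess k x) r"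
  shows "r < q \<Longrightarrow> excess k (bump k r x) q < excess k (bump k r x) r"
    and "q < r \<Longrightarrow> excess k (bump k r x) q \<le> excess k (bump k r x) r"
proof -
  have "excess k x q \<le> excess k x r" "q < r \<Longrightarrow> excess k x q < excess k x r"
    using assms(2) unfolding top_argmax_def by blast+
  then show "r < q \<Longrightarrow> excess k (bump k r x) q < excess k (bump k r x) r"
    and "q < r \<Longrightarrow> excess k (bump k r x) q \<le> excess k (bump k r x) r"
    using assms(1) by (simp_all add: excess_bump)
qed

lemma raises_agree_inj:
  assumes "1 \<le> k" "raises k x y" "raises k x2 y2" "agree A y y2" "{k - 1, k, Suc k} \<subseteq> A"
  shows "agree A x x2"
proof -
  have eq: "excess k y = excess k y2"
    using assms(4,5) by (intro excess_cong) (auto simp: agree_def)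
  obtain r where r: "top_argmax (excess k x) r" and y: "y = bump k r x"
    using assms(2) by (auto simp: raises_def)
  obtain r2 where r2: "top_argmax (excess k x2) r2" and y2: "y2 = bump k r2 x2"
    using assms(3) by (auto simp: raises_def)
  note mx = excess_bump_max[OF assms(1) r, folded y] excess_bump_max[OF assms(1) r2, folded y2]
  have "r = r2"
    using mx(1)[of r2] mx(2)[of r2] mx(3)[of r] mx(4)[of r] eq
    by (cases r r2 rule: linorder_cases) simp_all
  have "x j = x2 j" if "j \<in> A" for j
  proof (cases "j = k")
    case True
    then have "(x k)(r := x k r + 1) = (x2 k)(r := x2 k r + 1)"
      using assms(4) that \<open>r = r2\<close> unfolding agree_def y y2 bump_def
      by (metis fun_upd_same)
    then have "x k q = x2 k q" for q
      by (cases "q = r") (auto dest: fun_cong[of _ _ q])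
    then show ?thesis using True by blast
  next
    case False
    then show ?thesis using assms(4) that by (auto simp: agree_def y y2 bump_def)
  qed
  then show ?thesis by (simp add: agree_def)
qed

text \<open>At the first maximum the excess strictly increases (or is positive in row 0). Row
  \<open>r\<close> thus has a letter \<open>k + 1\<close> to change, and interlacing with the row
  above leaves room for the new \<open>k\<close>.\<close>

lemma raises_gt_pattern:
  assumes x: "gt_pattern x" and k: "1 \<le> k" and "raises k x y"
  shows "gt_pattern y"
proof -
  obtain r where r: "top_argmax (excess k x) r" "0 < excess k x r" and y: "y = bump k r x"
    using assms(3) by (auto simp: raises_def)
  obtain l where l: "k = Suc l" using k by (cases k) auto
  have "x k r < x (Suc k) r \<and> (\<forall>p. r = Suc p \<longrightarrow> x k r < x l p)"
  proof (cases r)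
    case 0
    then show ?thesis using r by (simp add: excess_0)
  next
    case (Suc p)
    then have "0 < (x (Suc k) r - x k r) - (x k p - x l p)"
      using r by (auto simp: top_argmax_def excess_Suc l dest: spec[of _ p])
    then show ?thesis
      using Suc gt_patternD(2)[OF x, of l p] gt_patternD(3)[OF x, of k p] by (auto simp: l)
  qed
  then have up: "x k r + 1 \<le> x (Suc k) r" "\<And>p. r = Suc p \<Longrightarrow> x k r + 1 \<le> x l p" by auto
  have *: "bump k r x j = x j" if "j \<noteq> k" for j using that by (simp add: bump_def)
  have ge: "x k q \<le> bump k r x k q" for q by (simp add: bump_def)
  have le: "bump k r x k q \<le> x (Suc k) q" "bump k r x k (Suc q) \<le> x l q" for q
    using up gt_patternD(2)[OF x, of k q] gt_patternD(3)[OF x, of l q] by (auto simp: bump_def l)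
  have "bump k r x j q \<le> bump k r x (Suc j) q \<and> bump k r x (Suc j) (Suc q) \<le> bump k r x j q" for j q
    using gt_patternD(2,3)[OF x, of j q] ge[of q] le[of q] l *
    by (cases "j = k"; cases "j = l") (auto intro: order_trans)
  moreover have "bump k r x 0 = (\<lambda>_. 0)" using gt_patternD(1)[OF x] * k by auto
  ultimately show ?thesis by (simp add: gt_pattern_def y)
qed

lemma highest_or_raises:
  assumes x: "gt_pattern x"
  shows "highest k x \<or> (\<exists>y. raises k x y)"
proof (cases "highest k x")
  case False
  define S where "S = excess k x"
  obtain r0 where r0: "0 < S r0" using False by (auto simp: highest_def S_def not_le)
  \<comment> \<open>From row \<open>k + 1\<close> on the increments vanish, so the maximum over all
    rows is one over a finite range.\<close>
  have const: "S q = S (Suc k)" if "Suc k \<le> q" for q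
    using that
  proof (induction q rule: dec_induct)
    case (step q)
    then have "x (Suc k) (Suc q) = 0" "x k (Suc q) = 0" "x k q = 0" "x (k - 1) q = 0"
      using gt_pattern_eq_0[OF x] by auto
    then show ?case using step by (simp add: S_def excess_Suc)
  qed simp
  define M where "M = Max (S ` {..Suc k})"
  have M: "S q \<le> M" for q
    unfolding M_def using const[of q] by (cases "q \<le> Suc k") auto
  have "M \<in> S ` {..Suc k}" unfolding M_def by (intro Max_in) auto
  then have ex: "\<exists>r. S r = M" by auto
  define r where "r = (LEAST r. S r = M)"
  have r: "S r = M" unfolding r_def using ex by (rule LeastI_ex)
  have "S q < M" if "q < r" for q
    using M[of q] not_less_Least[of q "\<lambda>r. S r = M"] that by (auto simp: r_def)
  then have "top_argmax S r" using M r by (auto simp: top_argmax_def)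
  moreover have "0 < S r" using M[of r0] r r0 by simp
  ultimately show ?thesis by (auto simp: raises_def S_def)
qed simp

section \<open>Rectangle operators and crystal raising operators\<close>

lemma excess_toggle_far:
  assumes "i + 2 \<le> k \<or> k + 2 \<le> i"
  shows "excess k (toggle i x) = excess k x"
  using assms by (intro excess_cong) auto

lemma toggle_bump_far:
  assumes "i + 2 \<le> k \<or> k + 2 \<le> i"
  shows "toggle i (bump k r x) = bump k r (toggle i x)"
proof
  fix j
  have "toggle i (bump k r x) i = toggle i x i"
    using assms by (intro toggle_cong) (auto simp: bump_def)
  then show "toggle i (bump k r x) j = bump k r (toggle i x) j"
    using assms by (cases "j = i") (auto simp: bump_def)
qed

lemma foldr_toggle_far:
  assumes "\<forall>i\<in>set is. i + 2 \<le> k \<or> k + 2 \<le> i"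
  shows raises_foldr_toggle_far: "raises k x y \<Longrightarrow> raises k (foldr toggle is x) (foldr toggle is y)"
    and highest_foldr_toggle_far: "highest k x \<Longrightarrow> highest k (foldr toggle is x)"
  using assms
  by (induction "is")
    (auto simp: raises_def highest_def excess_toggle_far toggle_bump_far)

text \<open>Isolates the adjacent pair \<open>Suc j, j\<close>: the indices applied before it are
  far from \<open>Suc j\<close>, those applied after it are far from \<open>j\<close>. Only this
  pair acts on the crystal index, lowering it by one.\<close>

lemma down_word_split_at:
  assumes "1 \<le> a" "a \<le> j" "j < b"
  shows "down_word b a = down_word b (Suc (Suc j)) @ [Suc j, j] @ down_word (j - 1) a"
proof -
  obtain i where "j = Suc i" using assms by (cases j) auto
  then show ?thesis
    using assms down_word_split[of a "Suc j" b] by (simp add: down_word_Suc)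
qed

lemma raises_pdown:
  assumes "1 \<le> a" "a \<le> j" "j < b" "raises (Suc j) x y"
  shows "raises j (pdown b a x) (pdown b a y)"
proof -
  let ?x = "pdown (j - 1) a x" and ?y = "pdown (j - 1) a y"
  have "raises (Suc j) ?x ?y"
    using assms by (intro raises_foldr_toggle_far) auto
  then have "raises j (toggle (Suc j) (toggle j ?x)) (toggle (Suc j) (toggle j ?y))"
    using assms by (intro raises_toggle_toggle) auto
  then show ?thesis
    unfolding down_word_split_at[OF assms(1-3)]
    by (auto intro: raises_foldr_toggle_far)
qed

lemma highest_pdown:
  assumes "1 \<le> a" "a \<le> j" "j < b" "highest (Suc j) x"
  shows "highest j (pdown b a x)"
proof -
  let ?x = "pdown (j - 1) a x"
  have "highest (Suc j) ?x"
    using assms by (intro highest_foldr_toggle_far) auto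
  then have "highest j (toggle (Suc j) (toggle j ?x))"
    using assms by (intro highest_toggle_toggle) auto
  then show ?thesis
    unfolding down_word_split_at[OF assms(1-3)]
    by (auto intro: highest_foldr_toggle_far)
qed

lemma raises_prect:
  assumes "1 \<le> i" "i < s" "raises (r + i) x y"
  shows "raises i (prect r s x) (prect r s y)"
  using assms(3)
proof (induction r arbitrary: x y)
  case (Suc r)
  then show ?case
    using Suc.IH[OF raises_pdown[of "Suc r" "r + i" "s + r" x y]] assms(1,2)
    by (simp add: rect_word_Suc)
qed simp

lemma highest_prect:
  assumes "1 \<le> i" "i < s" "highest (r + i) x"
  shows "highest i (prect r s x)"
  using assms(3)
proof (induction r arbitrary: x)
  case (Suc r)
  then show ?case
    using Suc.IH[OF highest_pdown[of "Suc r" "r + i" "s + r" x]] assms(1,2)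
    by (simp add: rect_word_Suc)
qed simp

section \<open>Paths of raising operators inside a band\<close>

text \<open>Indices are relative to the offset \<open>b\<close>, so one list can be followed in
  bands at different offsets.\<close>

fun path :: "nat \<Rightarrow> nat list \<Rightarrow> pattern \<Rightarrow> pattern \<Rightarrow> bool" where
  "path b [] x y \<longleftrightarrow> x = y"
| "path b (k # ks) x y \<longleftrightarrow> (\<exists>z. raises (b + k) x z \<and> path b ks z y)"

definition highest_band :: "nat \<Rightarrow> nat \<Rightarrow> pattern \<Rightarrow> bool" where
  "highest_band b u x \<longleftrightarrow> (\<forall>k\<in>{1..<u}. highest (b + k) x)"

lemma path_other:
  "path b ks x y \<Longrightarrow> set ks \<subseteq> {1..<u} \<Longrightarrow> j \<le> b \<or> b + u \<le> j \<Longrightarrow> y j = x j"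
  by (induction ks arbitrary: x) (auto dest!: raises_other[of _ _ _ j])

lemma path_gt_pattern:
  "path b ks x y \<Longrightarrow> set ks \<subseteq> {1..<u} \<Longrightarrow> gt_pattern x \<Longrightarrow> gt_pattern y"
proof (induction ks arbitrary: x)
  case (Cons k ks)
  then obtain z where z: "raises (b + k) x z" "path b ks z y" by auto
  then have "gt_pattern z" using Cons.prems by (intro raises_gt_pattern[of x _ z]) auto
  then show ?case using Cons.IH[OF z(2)] Cons.prems by simp
qed simp

lemma path_agree:
  "path b ks x y \<Longrightarrow> set ks \<subseteq> {1..<u} \<Longrightarrow> agree {b..b + u} x x2 \<Longrightarrow>
    \<exists>y2. path b ks x2 y2 \<and> agree {b..b + u} y y2"
proof (induction ks arbitrary: x x2)
  case (Cons k ks)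
  then obtain z where z: "raises (b + k) x z" "path b ks z y" by auto
  have k: "1 \<le> b + k" "{b + k - 1, b + k, Suc (b + k)} \<subseteq> {b..b + u}"
    using Cons.prems(2) by auto
  obtain z2 where "raises (b + k) x2 z2" "agree {b..b + u} z z2"
    using raises_agree[OF _ z(1) Cons.prems(3)] k by auto
  then show ?case using Cons.IH[OF z(2)] Cons.prems by fastforce
qed auto

lemma path_agree_inj:
  assumes "set ks \<subseteq> {1..<u}" "{b..b + u} \<subseteq> A" "agree A y y2"
  shows "path b ks x y \<Longrightarrow> path b ks x2 y2 \<Longrightarrow> agree A x x2"
  using assms(1)
proof (induction ks arbitrary: x x2)
  case (Cons k ks)
  then obtain z where z: "raises (b + k) x z" "path b ks z y" by auto
  obtain z2 where z2: "raises (b + k) x2 z2" "path b ks z2 y2" using Cons.prems by auto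
  have "agree A z z2" using Cons z z2 by auto
  moreover have "{b + k - 1, b + k, Suc (b + k)} \<subseteq> {b..b + u}"
    using Cons.prems(3) by auto
  then have "{b + k - 1, b + k, Suc (b + k)} \<subseteq> A" using assms(2) by blast
  ultimately show ?case using raises_agree_inj[OF _ z(1) z2(1)] Cons.prems(3) by auto
qed (use assms in simp)

lemma path_inj:
  assumes "set ks \<subseteq> {1..<u}" "path b ks x y" "path b ks x2 y"
  shows "x = x2"
  using path_agree_inj[OF assms(1), of b UNIV y y x x2] assms by (auto simp: agree_def)

lemma path_prect:
  assumes "d + u \<le> s"
  shows "set ks \<subseteq> {1..<u} \<Longrightarrow> path (a + d) ks x y \<Longrightarrow> path d ks (prect a s x) (prect a s y)"
proof (induction ks arbitrary: x)
  case (Cons k ks)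
  then obtain z where z: "raises (a + d + k) x z" "path (a + d) ks z y" by auto
  have "raises (d + k) (prect a s x) (prect a s z)"
    using z(1) Cons.prems(1) assms by (intro raises_prect) (auto simp: add.assoc)
  then show ?case using Cons.IH[OF _ z(2)] Cons.prems(1) by auto
qed simp

lemma highest_band_prect:
  assumes "d + u \<le> s" "highest_band (a + d) u x"
  shows "highest_band d u (prect a s x)"
  unfolding highest_band_def
proof
  fix k assume "k \<in> {1..<u}"
  then show "highest (d + k) (prect a s x)"
    using assms by (intro highest_prect) (auto simp: highest_band_def add.assoc)
qed

text \<open>A raise available after rectification must already be available before it, since
  \<open>highest_prect\<close> would otherwise forbid it; uniqueness of raises then identifies the
  results.\<close>

lemma path_prect_converse:
  "set ks \<subseteq> {1..<u} \<Longrightarrow> gt_pattern x \<Longrightarrow> path 0 ks (prect b u x) v \<Longrightarrow>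
    \<exists>y. path b ks x y \<and> prect b u y = v"
proof (induction ks arbitrary: x)
  case (Cons k ks)
  then obtain w where w: "raises k (prect b u x) w" "path 0 ks w v" by auto
  have k: "1 \<le> k" "k < u" using Cons.prems by auto
  have "\<not> highest (b + k) x"
    using w(1) highest_prect[OF k, of b x] by (meson highest_def raises_def not_le)
  then obtain z where z: "raises (b + k) x z"
    using highest_or_raises[OF Cons.prems(2)] by blast
  then have "w = prect b u z"
    using raises_prect[OF k z] w(1) raises_unique by blast
  moreover have "gt_pattern z"
    using z k Cons.prems(2) by (intro raises_gt_pattern[of x _ z]) auto
  ultimately show ?case
    using Cons.IH[of z] Cons.prems(1) w(2) z by auto
qed simp

lemma level_sum_raises:
  assumes "gt_pattern x" "raises k x y" "1 \<le> k" "k \<le> N"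
  shows "level_sum N k y = level_sum N k x + 1"
proof -
  obtain r where y: "y = bump k r x" using assms(2) by (auto simp: raises_def)
  have "gt_pattern y" using assms by (intro raises_gt_pattern[of x k y])
  moreover have "x k r \<ge> 0" using assms(1) by (rule gt_pattern_nonneg)
  then have "y k r \<noteq> 0" by (simp add: y bump_def)
  ultimately have "r < k" using gt_pattern_eq_0[of y k r] by (meson not_le)
  then have "level_sum N k y = (\<Sum>q\<le>N. x k q + (if q = r then 1 else 0))"
    unfolding level_sum_def y bump_def by (intro sum.cong) auto
  also have "\<dots> = level_sum N k x + 1"
    using \<open>r < k\<close> assms(4) by (simp add: sum.distrib level_sum_def)
  finally show ?thesis .
qed

text \<open>Each raise inside the band increases one level sum strictly between \<open>b\<close> and
  \<open>b + u\<close> by one, while all are bounded by the one at \<open>b + u\<close>; the total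
  deficit is the measure.\<close>

lemma ex_path_highest:
  assumes "gt_pattern x"
  shows "\<exists>ks y. set ks \<subseteq> {1..<u} \<and> path b ks x y \<and> highest_band b u y"
  using assms
proof (induction "nat (\<Sum>k\<in>{1..<u}. level_sum (b + u) (b + u) x - level_sum (b + u) (b + k) x)"
    arbitrary: x rule: less_induct)
  case less
  let ?L = "level_sum (b + u)"
  show ?case
  proof (cases "highest_band b u x")
    case True
    then show ?thesis by (intro exI[of _ "[]"]) auto
  next
    case False
    then obtain k where k: "k \<in> {1..<u}" "\<not> highest (b + k) x"
      by (auto simp: highest_band_def)
    then obtain z where z: "raises (b + k) x z"
      using highest_or_raises[OF less.prems] by blast
    have gz: "gt_pattern z" using z k less.prems by (intro raises_gt_pattern[of x _ z]) auto
    have nn: "0 \<le> ?L (b + u) z - ?L (b + j) z" if "j \<in> {1..<u}" for j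
      using that gt_pattern_mono[OF gz, of "b + j" "b + u"] by (auto simp: level_sum_def intro!: sum_mono)
    have same: "?L j z = ?L j x" if "j \<noteq> b + k" for j
      using raises_other[OF z that] by (simp add: level_sum_def)
    have "(\<Sum>j\<in>{1..<u}. ?L (b + u) z - ?L (b + j) z) < (\<Sum>j\<in>{1..<u}. ?L (b + u) x - ?L (b + j) x)"
    proof (rule sum_strict_mono_ex1)
      have "?L (b + k) z = ?L (b + k) x + 1"
        using k by (intro level_sum_raises[OF less.prems z]) auto
      moreover have "?L (b + u) z = ?L (b + u) x" using k by (intro same) auto
      moreover have "?L (b + j) x \<le> ?L (b + j) z" for j
        using same[of "b + j"] calculation(1) by (cases "j = k") auto
      ultimately show "\<exists>j\<in>{1..<u}. ?L (b + u) z - ?L (b + j) z < ?L (b + u) x - ?L (b + j) x"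
        "\<forall>j\<in>{1..<u}. ?L (b + u) z - ?L (b + j) z \<le> ?L (b + u) x - ?L (b + j) x"
        using k(1) by (auto intro!: bexI[of _ k])
    qed simp
    moreover have "0 \<le> (\<Sum>j\<in>{1..<u}. ?L (b + u) z - ?L (b + j) z)"
      using nn by (intro sum_nonneg)
    ultimately have "nat (\<Sum>j\<in>{1..<u}. ?L (b + u) z - ?L (b + j) z) <
        nat (\<Sum>j\<in>{1..<u}. ?L (b + u) x - ?L (b + j) x)"
      by (simp only: nat_less_eq_zless)
    from less.hyps[OF this gz]
    obtain ks y where "set ks \<subseteq> {1..<u}" "path b ks z y" "highest_band b u y"
      by blast
    then show ?thesis using z k by (intro exI[of _ "k # ks"] exI[of _ y]) auto
  qed
qed

section \<open>Highest weight patterns of straight shape\<close>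

text \<open>In such a tableau row \<open>q\<close> carries only the letter \<open>q + 1\<close>
  among the letters up to \<open>u\<close>. By induction the subtracted sum in the excess is zero,
  so the excess is a sum of nonnegative terms that must be at most 0.\<close>

lemma highest_band_step:
  assumes x: "gt_pattern x" and hw: "highest_band 0 u x"
  shows "k < u \<Longrightarrow> q < k \<Longrightarrow> x k q = x (Suc k) q"
proof (induction k arbitrary: q)
  case (Suc k)
  have "x (Suc k) p - x k p = 0" if "p < q" for p
    using Suc.IH[of p] Suc.prems that by simp
  then have "excess (Suc k) x q = (\<Sum>p\<le>q. x (Suc (Suc k)) p - x (Suc k) p)"
    by (simp add: excess_def)
  moreover have "excess (Suc k) x q \<le> 0"
    using hw Suc.prems by (auto simp: highest_band_def highest_def)
  moreover have nn: "\<forall>p\<in>{..q}. 0 \<le> x (Suc (Suc k)) p - x (Suc k) p"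
    using gt_patternD(2)[OF x] by simp
  ultimately have "(\<Sum>p\<le>q. x (Suc (Suc k)) p - x (Suc k) p) = 0"
    by (metis (no_types, lifting) antisym sum_nonneg)
  then show ?case using nn by (subst (asm) sum_nonneg_eq_0_iff) auto
qed simp

lemma highest_band_level:
  assumes "gt_pattern x" "highest_band 0 u x" "k \<le> u" "q < k"
  shows "x k q = x u q"
  using assms(3,4)
proof (induction k rule: inc_induct)
  case (step k)
  then show ?case using highest_band_step[OF assms(1,2), of k q] by simp
qed simp

lemma level_sum_highest_band:
  assumes "gt_pattern x" "highest_band 0 u x" "k \<le> u" "u \<le> N"
  shows "level_sum N k x = (\<Sum>q<k. x u q)"
proof -
  have "level_sum N k x = (\<Sum>q<k. x k q)"
    unfolding level_sum_def using assms gt_pattern_eq_0[OF assms(1), of k]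
    by (intro sum.mono_neutral_right) auto
  then show ?thesis using highest_band_level[OF assms(1-3)] by simp
qed

lemma highest_band_agree:
  assumes x: "gt_pattern x" "highest_band 0 u x" and y: "gt_pattern y" "highest_band 0 u y"
    and "u \<le> N" "\<forall>k\<le>u. level_sum N k x = level_sum N k y"
  shows "agree {0..u} x y"
proof -
  have u: "z u q = level_sum N (Suc q) z - level_sum N q z"
    if "gt_pattern z" "highest_band 0 u z" "q < u" for z q
    using that assms(5) by (simp add: level_sum_highest_band)
  have u: "x u q = y u q" if "q < u" for q
    using u[OF x that] u[OF y that] assms(6) that by simp
  have "x k q = y k q" if "k \<le> u" for k q
  proof (cases "q < k")
    case True
    then show ?thesis
      using highest_band_level[OF x that] highest_band_level[OF y that] u[of q] that by simp
  next
    case False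
    then show ?thesis using gt_pattern_eq_0 x y by (metis not_less)
  qed
  then show ?thesis by (auto simp: agree_def)
qed

section \<open>Evacuation of a band of letters\<close>

definition band_evac :: "nat \<Rightarrow> nat \<Rightarrow> pattern \<Rightarrow> pattern" where
  "band_evac b u x = prect u b (pevac u (prect b u x))"

lemma band_evac_band_evac [simp]: "band_evac b u (band_evac b u x) = x"
  by (simp add: band_evac_def)

lemma band_evac_0: "band_evac 0 u x = pevac u x"
  by (simp add: band_evac_def)

lemma gt_pattern_band_evac: "gt_pattern x \<Longrightarrow> gt_pattern (band_evac b u x)"
  by (simp add: band_evac_def gt_pattern_prect gt_pattern_pevac)

text \<open>Both rectified endpoints are highest and of equal weight, hence equal up to level
  \<open>u\<close>. Injectivity of raising carries this back along the common path
  \<open>g\<close>.\<close>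

lemma prect_agree_of_highest:
  assumes "gt_pattern x" "set g \<subseteq> {1..<u}" "path b g x y" "highest_band b u y"
    and "gt_pattern x2" "path d g x2 y2" "highest_band d u y2"
    and "b + u \<le> N" "d + u \<le> N"
    and "\<forall>k\<le>u. level_sum N (b + k) y - level_sum N b y = level_sum N (d + k) y2 - level_sum N d y2"
  shows "agree {0..u} (prect b u x) (prect d u x2)"
proof (rule path_agree_inj[of g u 0 _ "prect b u y" "prect d u y2"])
  have y: "gt_pattern y" "gt_pattern y2"
    using path_gt_pattern assms by blast+
  show "agree {0..u} (prect b u y) (prect d u y2)"
  proof (rule highest_band_agree)
    show "highest_band 0 u (prect b u y)" "highest_band 0 u (prect d u y2)"
      using highest_band_prect[of 0 u u] assms by auto
    show "\<forall>k\<le>u. level_sum N k (prect b u y) = level_sum N k (prect d u y2)"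
      using assms y by (auto simp: level_sum_prect)
    show "u \<le> N" using assms by simp
  qed (use y in \<open>auto intro: gt_pattern_prect\<close>)
  show "path 0 g (prect b u x) (prect b u y)" "path 0 g (prect d u x2) (prect d u y2)"
    using path_prect[of 0 u u] assms by auto
qed (use assms in auto)

text \<open>Band evacuation stays in the crystal component: after rectification, \<open>g\<close>
  and \<open>h\<close> lead to highest elements of the same shape, hence to the same one, and
  \<open>h\<close> is then pulled back through the rectangle operator.\<close>

lemma path_band_evac:
  assumes x: "gt_pattern x" and g: "set g \<subseteq> {1..<u}" "path b g x y" "highest_band b u y"
    and h: "set h \<subseteq> {1..<u}" "path 0 h (pevac u (prect b u x)) v" "highest_band 0 u v"
  shows "path b h (band_evac b u x) y"
proof -
  let ?x = "band_evac b u x" and ?r = "prect b u x"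
  have rx: "prect b u ?x = pevac u ?r" by (simp add: band_evac_def)
  obtain z where z: "path b h ?x z" "prect b u z = v"
    using path_prect_converse[OF h(1) gt_pattern_band_evac[OF x], of b b u v] h(2) rx by auto
  have "gt_pattern (pevac u ?r)" using x by (intro gt_pattern_pevac gt_pattern_prect)
  then have gv: "gt_pattern v" using path_gt_pattern h by blast
  have gy: "gt_pattern (prect b u y)"
    using path_gt_pattern g x gt_pattern_prect by blast
  have py: "path 0 g ?r (prect b u y)"
    using path_prect[of 0 u u] g by auto
  \<comment> \<open>Neither the raising paths nor evacuation touch levels from \<open>u\<close> on,
    so the two highest elements share the shape at level \<open>u\<close>.\<close>
  have out: "v j = prect b u y j" if "u \<le> j" for j
  proof -
    have "v j = pevac u ?r j" using path_other[OF h(2,1)] that by simp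
    also have "\<dots> = ?r j" using that by (intro foldr_toggle_other) (auto simp: set_evac_word)
    also have "\<dots> = prect b u y j" using path_other[OF py g(1)] that by simp
    finally show ?thesis .
  qed
  have hy: "highest_band 0 u (prect b u y)" using highest_band_prect[of 0 u u] g by auto
  have "\<forall>k\<le>u. level_sum u k v = level_sum u k (prect b u y)"
    using level_sum_highest_band[OF gv h(3)] level_sum_highest_band[OF gy hy] out[of u] by simp
  then have "agree {0..u} v (prect b u y)"
    using highest_band_agree[OF gv h(3) gy hy, of u] by simp
  then have "v j = prect b u y j" for j
    using out[of j] by (cases "j \<le> u") (auto simp: agree_def)
  then have "v = prect b u y" by blast
  then have "z = y" using z(2) prect_inject by metis
  then show ?thesis using z by simp
qed

lemma pevac_agree:
  "agree {0..u} x y \<Longrightarrow> agree {0..u} (pevac u x) (pevac u y)"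
  by (intro foldr_toggle_agree) (auto simp: set_evac_word)

lemma highest_band_cong:
  assumes "agree {b..b + u} x y" "highest_band b u x" shows "highest_band b u y"
  unfolding highest_band_def
proof
  fix k assume k: "k \<in> {1..<u}"
  then have "{b + k - 1, b + k, Suc (b + k)} \<subseteq> {b..b + u}" by auto
  then have "excess (b + k) x = excess (b + k) y"
    using assms(1) by (intro excess_cong) (auto simp: agree_def)
  moreover have "highest (b + k) x" using assms(2) k by (simp add: highest_band_def)
  ultimately show "highest (b + k) y" by (simp add: highest_def)
qed

text \<open>Both \<open>x\<close> and its image reach the same \<open>y\<close> by raises inside the
  band, so other levels are fixed. If \<open>x2\<close> agrees with \<open>x\<close> on the band,
  then \<open>g\<close> applies to it as well, the rectifications agree, the same \<open>h\<close>
  serves both evacuations, and going back along \<open>h\<close> is injective.\<close>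

lemma band_evac_local:
  assumes x: "gt_pattern x"
  shows band_evac_other: "k \<le> b \<or> b + u \<le> k \<Longrightarrow> band_evac b u x k = x k"
    and band_evac_agree:
      "gt_pattern x2 \<Longrightarrow> agree {b..b + u} x x2 \<Longrightarrow>
        agree {b..b + u} (band_evac b u x) (band_evac b u x2)"
proof -
  obtain g y where g: "set g \<subseteq> {1..<u}" "path b g x y" "highest_band b u y"
    using ex_path_highest[OF x] by blast
  have "gt_pattern (pevac u (prect b u x))"
    using x by (intro gt_pattern_pevac gt_pattern_prect)
  then obtain h v where h: "set h \<subseteq> {1..<u}" "path 0 h (pevac u (prect b u x)) v" "highest_band 0 u v"
    using ex_path_highest[of _ u 0] by blast
  have p: "path b h (band_evac b u x) y" using path_band_evac[OF x g h] .
  show "band_evac b u x k = x k" if "k \<le> b \<or> b + u \<le> k"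
    using path_other[OF p h(1) that] path_other[OF g(2,1) that] by simp
  assume x2: "gt_pattern x2" and ag: "agree {b..b + u} x x2"
  obtain y2 where y2: "path b g x2 y2" "agree {b..b + u} y y2"
    using path_agree[OF g(2,1) ag] by blast
  have hy2: "highest_band b u y2" using highest_band_cong y2(2) g(3) by blast
  have "agree {0..u} (prect b u x) (prect b u x2)"
    using y2 by (intro prect_agree_of_highest[OF x g x2 y2(1) hy2, of "b + u"])
      (auto simp: agree_def level_sum_def)
  then have "agree {0..0 + u} (pevac u (prect b u x)) (pevac u (prect b u x2))"
    by (simp add: pevac_agree)
  then obtain v2 where v2: "path 0 h (pevac u (prect b u x2)) v2" "agree {0..0 + u} v v2"
    using path_agree[OF h(2,1)] by blast
  then have "path b h (band_evac b u x2) y2"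
    using highest_band_cong[OF v2(2) h(3)] by (intro path_band_evac[OF x2 g(1) y2(1) hy2 h(1)])
  then show "agree {b..b + u} (band_evac b u x) (band_evac b u x2)"
    using path_agree_inj[OF h(1) _ y2(2) p] by blast
qed

text \<open>The rectified band is the same before and after \<open>prect a s\<close>, so one path
  \<open>h\<close> takes both sides to the same highest element, and paths are injective.\<close>

lemma prect_band_evac:
  assumes x: "gt_pattern x" and "d + u \<le> s"
  shows "prect a s (band_evac (a + d) u x) = band_evac d u (prect a s x)"
proof -
  obtain g y where g: "set g \<subseteq> {1..<u}" "path (a + d) g x y" "highest_band (a + d) u y"
    using ex_path_highest[OF x] by blast
  have "gt_pattern (pevac u (prect (a + d) u x))"
    using x by (intro gt_pattern_pevac gt_pattern_prect)
  then obtain h v where h: "set h \<subseteq> {1..<u}" "path 0 h (pevac u (prect (a + d) u x)) v"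
      "highest_band 0 u v"
    using ex_path_highest[of _ u 0] by blast
  have p: "path (a + d) h (band_evac (a + d) u x) y" using path_band_evac[OF x g h] .
  have gy: "gt_pattern y" using path_gt_pattern g x by blast
  let ?x2 = "prect a s x" and ?y2 = "prect a s y"
  have x2: "gt_pattern ?x2" using x by (rule gt_pattern_prect)
  have y2: "path d g ?x2 ?y2" "highest_band d u ?y2"
    using path_prect[OF assms(2)] highest_band_prect[OF assms(2)] g by blast+
  have "agree {0..u} (prect (a + d) u x) (prect d u ?x2)"
    using assms(2) gy by (intro prect_agree_of_highest[OF x g x2 y2, of "a + s"])
      (auto simp: level_sum_prect add.assoc)
  then have "agree {0..0 + u} (pevac u (prect (a + d) u x)) (pevac u (prect d u ?x2))"
    by (simp add: pevac_agree)
  then obtain v2 where v2: "path 0 h (pevac u (prect d u ?x2)) v2" "agree {0..0 + u} v v2"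
    using path_agree[OF h(2,1)] by blast
  then have "path d h (band_evac d u ?x2) ?y2"
    using highest_band_cong[OF v2(2) h(3)] by (intro path_band_evac[OF x2 g(1) y2 h(1)])
  moreover have "path d h (prect a s (band_evac (a + d) u x)) ?y2"
    using path_prect[OF assms(2) h(1) p] .
  ultimately show ?thesis using path_inj[OF h(1)] by blast
qed

lemma band_evac_commute:
  assumes x: "gt_pattern x" and "b + u \<le> c"
  shows "band_evac b u (band_evac c v x) = band_evac c v (band_evac b u x)"
proof
  fix k
  note g = gt_pattern_band_evac[OF x]
  have 1: "band_evac c v x j = x j" if "j \<le> c \<or> c + v \<le> j" for j
    using band_evac_other[OF x that] .
  have 2: "band_evac b u x j = x j" if "j \<le> b \<or> b + u \<le> j" for j
    using band_evac_other[OF x that] .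
  have "agree {b..b + u} x (band_evac c v x)" using 1 assms(2) by (auto simp: agree_def)
  then have a: "agree {b..b + u} (band_evac b u x) (band_evac b u (band_evac c v x))"
    by (rule band_evac_agree[OF x g])
  have "agree {c..c + v} x (band_evac b u x)" using 2 assms(2) by (auto simp: agree_def)
  then have b: "agree {c..c + v} (band_evac c v x) (band_evac c v (band_evac b u x))"
    by (rule band_evac_agree[OF x g])
  consider "b \<le> k" "k \<le> b + u" | "c \<le> k" "k \<le> c + v" | "k < b \<or> b + u < k" "k < c \<or> c + v < k"
    by linarith
  then show "band_evac b u (band_evac c v x) k = band_evac c v (band_evac b u x) k"
  proof cases
    case 1
    then have "band_evac c v (band_evac b u x) k = band_evac b u x k"
      using assms(2) by (intro band_evac_other[OF g]) auto
    then show ?thesis using a 1 by (auto simp: agree_def)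
  next
    case 2
    then have "band_evac b u (band_evac c v x) k = band_evac c v x k"
      using assms(2) by (intro band_evac_other[OF g]) auto
    then show ?thesis using b 2 by (auto simp: agree_def)
  next
    case 3
    then show ?thesis using band_evac_other[OF g] 1 2 by (metis less_imp_le)
  qed
qed

section \<open>Relations between band evacuations\<close>

text \<open>By \<open>pevac_add\<close>, \<open>prect r s\<close> is a product of three evacuations.
  Substituting leaves an outer conjugation by \<open>pevac b\<close>, which cancels because the
  letters up to \<open>b\<close> are disjoint from the band.\<close>

lemma band_evac_eq_pevac:
  assumes "gt_pattern x"
  shows "band_evac b u x = pevac (b + u) (pevac u (pevac (b + u) x))"
proof -
  have R: "prect r s x = pevac s (pevac (r + s) (pevac r x))" for r s x
    by (simp add: pevac_add)
  have "band_evac b u x = pevac b (pevac (b + u) (pevac u (pevac (b + u) (pevac b x))))"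
    by (simp add: band_evac_def R add.commute)
  moreover have "band_evac b u (pevac b x) = pevac b (band_evac b u x)"
    using band_evac_commute[OF assms, of 0 b b u] by (simp add: band_evac_0)
  moreover have "pevac b (pevac b y) = y" for y by simp
  ultimately show ?thesis
    by (metis band_evac_def R add.commute pevac_pevac)
qed

text \<open>Evacuation reverses the order of letters, exchanging the offsets \<open>b\<close> and
  \<open>c\<close>. The two splittings of the outer evacuation reduce the conjugate to
  \<open>pevac u\<close>, which the rectangle operator transports to offset \<open>c\<close>;
  \<open>pevac c\<close> then cancels by disjointness.\<close>

lemma pevac_band_evac_pevac:
  assumes x: "gt_pattern x"
  shows "pevac (c + b + u) (band_evac b u (pevac (c + b + u) x)) = band_evac c u x"
proof -
  let ?v = "b + u"
  have E1: "pevac (c + ?v) y = pevac ?v (prect c ?v (pevac c y))" for y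
    by (rule pevac_add)
  have E2: "pevac (c + ?v) y = pevac c (prect ?v c (pevac ?v y))" for y
    using pevac_add[of ?v c y] by (simp add: add.commute)
  have gc: "gt_pattern (pevac c x)" using x by (rule gt_pattern_pevac)
  have "pevac (c + ?v) (band_evac b u (pevac (c + ?v) x)) =
      pevac c (prect ?v c (pevac ?v (pevac ?v (pevac u (pevac ?v (pevac ?v (prect c ?v (pevac c x))))))))"
    by (subst band_evac_eq_pevac[OF gt_pattern_pevac[OF x]], subst E1[of x], rule E2)
  also have "\<dots> = pevac c (prect ?v c (band_evac 0 u (prect c ?v (pevac c x))))"
    by (simp add: band_evac_0)
  also have "\<dots> = pevac c (band_evac c u (pevac c x))"
    using prect_band_evac[OF gc, of 0 u ?v c] by (metis add_0 add_0_right le_add2 prect_prect)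
  also have "band_evac c u (pevac c x) = pevac c (band_evac c u x)"
    using band_evac_commute[OF x, of 0 c c u] by (simp add: band_evac_0)
  also have "pevac c (pevac c (band_evac c u x)) = band_evac c u x"
    by simp
  finally show ?thesis by (simp add: add.assoc)
qed

lemma band_evac_conjugate:
  assumes x: "gt_pattern x"
  shows "band_evac a (c + d + u) (band_evac (a + d) u (band_evac a (c + d + u) x)) =
    band_evac (a + c) u x"
proof -
  let ?s = "c + d + u"
  let ?r = "prect a ?s x"
  have r: "gt_pattern ?r" using x by (rule gt_pattern_prect)
  have "prect a ?s (band_evac (a + d) u (band_evac a ?s x)) =
      band_evac d u (prect a ?s (band_evac a ?s x))"
    using x by (intro prect_band_evac gt_pattern_band_evac) auto
  also have "\<dots> = band_evac d u (pevac ?s ?r)"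
    by (simp add: band_evac_def)
  finally have "band_evac a ?s (band_evac (a + d) u (band_evac a ?s x)) =
      prect ?s a (pevac ?s (band_evac d u (pevac ?s ?r)))"
    by (simp add: band_evac_def)
  also have "pevac ?s (band_evac d u (pevac ?s ?r)) = band_evac c u ?r"
    by (rule pevac_band_evac_pevac[OF r])
  also have "\<dots> = prect a ?s (band_evac (a + c) u x)"
    using prect_band_evac[OF x, of c u ?s a] by simp
  finally show ?thesis by simp
qed

section \<open>Tableaux and their patterns\<close>

definition has_pattern :: "tableau \<Rightarrow> pattern \<Rightarrow> bool" where
  "has_pattern T x \<longleftrightarrow> gt_pattern x \<and>
     (\<forall>q c k. T (q, c) = Some k \<longleftrightarrow> 1 \<le> k \<and> x (k - 1) q \<le> int c \<and> int c < x k q)"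

lemma has_patternD:
  assumes "has_pattern T x"
  shows "gt_pattern x"
    "T (q, c) = Some k \<longleftrightarrow> 1 \<le> k \<and> x (k - 1) q \<le> int c \<and> int c < x k q"
  using assms by (auto simp: has_pattern_def)

lemma card_int_interval:
  assumes "0 \<le> l" "l \<le> u" shows "int (card {c. l \<le> int c \<and> int c < u}) = u - l"
proof -
  have "{c. l \<le> int c \<and> int c < u} = {nat l..<nat u}" using assms by auto
  then show ?thesis using assms by simp
qed

text \<open>In row \<open>q\<close> the free boxes are the columns from \<open>lower\<close> to
  \<open>upper\<close>, and \<open>x i q\<close> separates free \<open>i\<close> from free
  \<open>i + 1\<close>. Exchanging the two numbers reflects the separator, which is the
  toggle.\<close>

lemma has_pattern_bender_knuth:
  assumes T: "has_pattern T x" and "1 \<le> i"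
  shows "has_pattern (bender_knuth i T) (toggle i x)"
proof -
  note x = has_patternD(1)[OF T]
  note D = has_patternD(2)[OF T]
  obtain j where i: "i = Suc j" using assms(2) by (cases i) auto
  have low: "free_low i T (q, c) \<longleftrightarrow> lower i x q \<le> int c \<and> int c < x i q" for q c
    using gt_patternD(3)[OF x, of j q] by (auto simp: free_low_def D lower_def i)
  have high: "free_high i T (q, c) \<longleftrightarrow> x i q \<le> int c \<and> int c < upper i x q" for q c
    using gt_patternD(3)[OF x, of i] by (cases q) (auto simp: free_high_def D upper_def i less_le_trans)
  have lx: "lower i x q \<le> x i q" and xu: "x i q \<le> upper i x q" and l0: "0 \<le> lower i x q" for q
    using gt_pattern_bounds[OF x assms(2), of q] gt_pattern_nonneg[OF x, of "i - 1" q]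
    by (auto simp: lower_def)
  have free: "free_low i T (q, c) \<or> free_high i T (q, c) \<longleftrightarrow> lower i x q \<le> int c \<and> int c < upper i x q"
    for q c using lx[of q] xu[of q] by (auto simp: low high)
  have n: "card {c'. free_high i T (q, c')} = nat (upper i x q - x i q)" for q
    using card_int_interval[of "x i q" "upper i x q"] xu[of q] gt_pattern_nonneg[OF x, of i q]
    by (simp add: high)
  have m: "card {c'. c' < c \<and> lower i x q \<le> int c' \<and> int c' < upper i x q} = nat (int c - lower i x q)"
    if "lower i x q \<le> int c" "int c < upper i x q" for q c
  proof -
    have "{c'. c' < c \<and> lower i x q \<le> int c' \<and> int c' < upper i x q} =
        {c'. lower i x q \<le> int c' \<and> int c' < int c}"
      using that by auto
    then show ?thesis using card_int_interval[OF l0[of q] that(1)] by simp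
  qed
  have bk: "bender_knuth i T (q, c) =
      (if lower i x q \<le> int c \<and> int c < upper i x q
       then if int c < toggle i x i q then Some i else Some (Suc i) else T (q, c))" for q c
    using xu[of q] by (auto simp: bender_knuth_def free n m toggle_same)
  have "bender_knuth i T (q, c) = Some k \<longleftrightarrow>
      1 \<le> k \<and> toggle i x (k - 1) q \<le> int c \<and> int c < toggle i x k q" for q c k
  proof -
    have lt: "lower i x q \<le> toggle i x i q" and tu: "toggle i x i q \<le> upper i x q"
      using lx[of q] xu[of q] by (auto simp: toggle_same)
    have jl: "x j q \<le> lower i x q" and uS: "upper i x q \<le> x (Suc i) q"
      by (auto simp: lower_def upper_def i split: nat.split)
    have xm: "x (Suc i) q \<le> x k' q" if "Suc i \<le> k'" for k' using gt_pattern_mono[OF x that] .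
    have xj: "x k' q \<le> x j q" if "k' \<le> j" for k' using gt_pattern_mono[OF x that] .
    have ij: "i - Suc 0 = j" "toggle i x j = x j" by (auto simp: i)
    consider "k = i" | "k = Suc i" | "k < i" | "Suc i < k" by linarith
    then show ?thesis
    proof cases
      case 1
      then show ?thesis using jl uS lt tu lx[of q] xu[of q] assms(2) ij by (auto simp: bk D)
    next
      case 2
      then show ?thesis using jl uS lt tu lx[of q] xu[of q] by (auto simp: bk D)
    next
      case 3
      then have "x k q \<le> x j q" using i by (intro xj) simp
      then show ?thesis using 3 jl uS lt tu lx[of q] xu[of q] by (auto simp: bk D)
    next
      case 4
      then have "x (Suc i) q \<le> x (k - 1) q" by (intro xm) simp
      then show ?thesis using 4 jl uS lt tu lx[of q] xu[of q] by (auto simp: bk D)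
    qed
  qed
  then show ?thesis using gt_pattern_toggle[OF x assms(2)] by (auto simp: has_pattern_def)
qed

lemma has_pattern_foldr:
  "has_pattern T x \<Longrightarrow> 0 \<notin> set is \<Longrightarrow> has_pattern (foldr bender_knuth is T) (foldr toggle is x)"
  by (induction "is") (auto intro: has_pattern_bender_knuth)

lemma evac_conv: "evac m = foldr bender_knuth (evac_word m)"
proof -
  have "(\<lambda>k. bk_down k 1) = (\<lambda>k. foldr bender_knuth (down_word k 1))"
    by (simp add: bk_down_def down_word_def fun_eq_iff)
  then show ?thesis by (simp only: evac_def evac_word_def foldr_concat_map)
qed

lemma rect_op_conv: "rect_op r s = foldr bender_knuth (rect_word r s)"
proof -
  have "(\<lambda>k. bk_down (s + k - 1) k) = (\<lambda>k. foldr bender_knuth (down_word (s + k - 1) k))"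
    by (simp add: bk_down_def down_word_def fun_eq_iff)
  then show ?thesis by (simp only: rect_op_def rect_word_def foldr_concat_map)
qed

lemma has_pattern_band_evac:
  assumes "has_pattern S x"
  shows "has_pattern ((rect_op u b \<circ> evac u \<circ> rect_op b u) S) (band_evac b u x)"
  using assms set_rect_word[of b u] set_rect_word[of u b]
  by (auto simp: evac_conv rect_op_conv band_evac_def set_evac_word intro!: has_pattern_foldr)

lemma down_closed_eq_lessThan:
  fixes A :: "nat set"
  assumes "finite A" "\<And>a b. a \<in> A \<Longrightarrow> b \<le> a \<Longrightarrow> b \<in> A"
  shows "A = {..<card A}"
proof (cases "A = {}")
  case False
  have "A = {..Max A}" using assms False by (auto intro: assms(2)[OF Max_in])
  then show ?thesis by (metis card_atMost lessThan_Suc_atMost)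
qed simp

lemma mem_diagram_staircase: "(q, c) \<in> diagram (staircase m) \<longleftrightarrow> q + c < m"
  by (auto simp: diagram_def staircase_def rev_nth simp del: upt_Suc)

lemma ex_has_pattern:
  assumes S: "ssyt (diagram (staircase m)) S"
  shows "\<exists>x. has_pattern S x \<and> (\<forall>k q. (\<forall>v\<in>ran S. v \<le> k) \<longrightarrow> x k q = int (m - q))"
proof -
  \<comment> \<open>Weakly increasing rows make each \<open>A k q\<close> an initial segment of
    columns, so its size records it completely.\<close>
  define A where "A k q = {c. \<exists>v\<le>k. S (q, c) = Some v}" for k q
  have dom: "(\<exists>v. S (q, c) = Some v) \<longleftrightarrow> q + c < m" for q c
  proof -
    have "(\<exists>v. S (q, c) = Some v) \<longleftrightarrow> (q, c) \<in> dom S" by auto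
    also have "dom S = diagram (staircase m)" using S by (simp add: ssyt_def)
    finally show ?thesis by (simp only: mem_diagram_staircase)
  qed
  have pos: "S (q, c) = Some v \<Longrightarrow> 1 \<le> v" for q c v
    using S by (auto simp: ssyt_def ran_def)
  have row: "c < c' \<Longrightarrow> S (q, c) = Some v \<Longrightarrow> S (q, c') = Some v' \<Longrightarrow> v \<le> v'" for q c c' v v'
    using S unfolding ssyt_def by blast
  have col: "q < q' \<Longrightarrow> S (q, c) = Some v \<Longrightarrow> S (q', c) = Some v' \<Longrightarrow> v < v'" for q q' c v v'
    using S unfolding ssyt_def by blast
  have A: "A k q = {..<card (A k q)}" for k q
  proof (rule down_closed_eq_lessThan)
    have "c \<in> {..<m}" if "c \<in> A k q" for c
      using dom[of q c] that by (auto simp: A_def)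
    then have "A k q \<subseteq> {..<m}" by blast
    then show "finite (A k q)" using finite_subset by blast
    fix a b assume "a \<in> A k q" "b \<le> a"
    then obtain v v' where "v \<le> k" "S (q, a) = Some v" "S (q, b) = Some v'"
      using dom[of q a] dom[of q b] by (auto simp: A_def)
    then show "b \<in> A k q"
      using row[of b a q v' v] \<open>b \<le> a\<close> by (cases "b = a") (auto simp: A_def)
  qed
  define x where "x k q = int (card (A k q))" for k q
  have mem: "int c < x k q \<longleftrightarrow> (\<exists>v\<le>k. S (q, c) = Some v)" for c k q
  proof -
    have "c \<in> A k q \<longleftrightarrow> c < card (A k q)" by (subst A) simp
    then show ?thesis by (simp add: x_def A_def)
  qed
  have le: "x k q \<le> x k' q'" if "A k q \<subseteq> A k' q'" for k q k' q'
  proof -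
    have "finite (A k' q')" by (subst A) simp
    then show ?thesis using card_mono that by (simp add: x_def)
  qed
  have "gt_pattern x"
    unfolding gt_pattern_def
  proof (intro conjI allI)
    have "A 0 q = {}" for q using pos by (force simp: A_def)
    then show "x 0 = (\<lambda>_. 0)" by (simp add: x_def fun_eq_iff)
    fix k q
    show "x k q \<le> x (Suc k) q" by (rule le) (auto simp: A_def)
    show "x (Suc k) (Suc q) \<le> x k q"
    proof (rule le, rule subsetI)
      fix c assume "c \<in> A (Suc k) (Suc q)"
      then obtain v v' where "v \<le> Suc k" "S (Suc q, c) = Some v" "S (q, c) = Some v'"
        using dom[of "Suc q" c] dom[of q c] by (auto simp: A_def)
      then show "c \<in> A k q" using col[of q "Suc q" c v' v] by (auto simp: A_def)
    qed
  qed
  moreover have "S (q, c) = Some k \<longleftrightarrow> 1 \<le> k \<and> x (k - 1) q \<le> int c \<and> int c < x k q" for q c k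
  proof -
    have "x (k - 1) q \<le> int c \<longleftrightarrow> \<not> (\<exists>v\<le>k - 1. S (q, c) = Some v)"
      by (simp only: not_less flip: mem)
    then show ?thesis using mem[of c k q] pos[of q c]
      by (cases "S (q, c)") auto
  qed
  moreover have "x k q = int (m - q)" if "\<forall>v\<in>ran S. v \<le> k" for k q
  proof -
    have "A k q = {c. q + c < m}"
      using dom[of q] that by (auto simp: A_def ran_def) blast
    also have "\<dots> = {..<m - q}" by auto
    finally show ?thesis by (simp add: x_def)
  qed
  ultimately show ?thesis by (auto simp: has_pattern_def)
qed

section \<open>Lifts of words\<close>

lemma ex_tableau:
  assumes x: "gt_pattern x" shows "\<exists>T. has_pattern T x"
proof -
  define T :: tableau where
    "T = (\<lambda>(q, c). if \<exists>k. int c < x k q then Some (LEAST k. int c < x k q) else None)"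
  have "T (q, c) = Some k \<longleftrightarrow> 1 \<le> k \<and> x (k - 1) q \<le> int c \<and> int c < x k q" for q c k
  proof
    assume "T (q, c) = Some k"
    then have ex: "\<exists>k. int c < x k q" and k: "k = (LEAST k. int c < x k q)"
      by (auto simp: T_def split: if_splits)
    have lt: "int c < x k q" unfolding k using ex by (rule LeastI_ex)
    then have "k \<noteq> 0" using gt_patternD(1)[OF x] by (cases k) auto
    moreover have "\<not> int c < x (k - 1) q"
      using not_less_Least[of "k - 1" "\<lambda>k. int c < x k q"] k \<open>k \<noteq> 0\<close> by simp
    ultimately show "1 \<le> k \<and> x (k - 1) q \<le> int c \<and> int c < x k q" using lt by auto
  next
    assume k: "1 \<le> k \<and> x (k - 1) q \<le> int c \<and> int c < x k q"
    have "(LEAST k. int c < x k q) = k"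
    proof (rule Least_equality)
      fix j assume "int c < x j q"
      show "k \<le> j"
      proof (rule ccontr)
        assume "\<not> k \<le> j"
        then have "x j q \<le> x (k - 1) q" by (intro gt_pattern_mono[OF x]) simp
        then show False using k \<open>int c < x j q\<close> by simp
      qed
    qed (use k in simp)
    then show "T (q, c) = Some k" using k by (auto simp: T_def)
  qed
  then show ?thesis using x by (auto simp: has_pattern_def)
qed

lemma word_tableau_inject:
  assumes "length w = length w'" "word_tableau w = word_tableau w'" shows "w = w'"
proof (rule nth_equalityI)
  fix c assume c: "c < length w"
  then have "Suc (length w' - Suc 0) = length w'" using assms(1) by simp
  then show "w ! c = w' ! c"
    using fun_cong[OF assms(2), of "(length w - 1 - c, c)"] assms(1) c
    by (simp add: word_tableau_def)
qed (rule assms(1))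

text \<open>Row lengths of the smaller staircase enlarged by the strip boxes with letters at most
  \<open>v\<close>; the strip box of row \<open>q\<close> lies in column
  \<open>length w - 1 - q\<close>.\<close>

definition word_level :: "nat list \<Rightarrow> nat \<Rightarrow> nat \<Rightarrow> int" where
  "word_level w v q = (if q < length w
     then int (length w - 1 - q) + (if w ! (length w - 1 - q) \<le> v then 1 else 0) else 0)"

text \<open>Letter \<open>v\<close> is the entry \<open>length w - 1 + v\<close> of a lift. Levels
  below \<open>length w - 1\<close> stay free apart from interlacing: this is exactly the choice of
  the lift.\<close>

definition lift_pattern :: "nat \<Rightarrow> nat list \<Rightarrow> pattern \<Rightarrow> bool" where
  "lift_pattern n w x \<longleftrightarrow> gt_pattern x \<and>
     (\<forall>v\<le>n. x (length w - 1 + v) = word_level w v) \<and>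
     (\<forall>k\<ge>length w - 1 + n. x k = word_level w n)"

lemma words_nth: "w \<in> words n \<Longrightarrow> c < length w \<Longrightarrow> 1 \<le> w ! c \<and> w ! c \<le> n"
  by (auto simp: words_def in_lists_conv_set)

lemma ex_lift_pattern:
  assumes "w \<in> words n" "w \<noteq> []" shows "\<exists>x. lift_pattern n w x"
proof -
  define M where "M = length w - 1"
  have len: "length w = Suc M" using assms(2) by (cases w) (auto simp: M_def)
  have nth: "1 \<le> w ! (M - q)" "w ! (M - q) \<le> n" for q
    using words_nth[OF assms(1), of "M - q"] len by auto
  \<comment> \<open>Below level \<open>M\<close> this is the filling of the smaller staircase whose
    row \<open>q\<close> consists of entries \<open>q + 1\<close>.\<close>
  define x :: pattern where
    "x k q = (if k < M then if q < k then int (M - q) else 0 else word_level w (k - M) q)" for k q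
  have gx: "gt_pattern x"
    unfolding gt_pattern_def
  proof (intro conjI allI)
    show "x 0 = (\<lambda>_. 0)" using nth(1)[of M] by (auto simp: x_def word_level_def len fun_eq_iff)
    fix k q
    show "x k q \<le> x (Suc k) q"
      using nth[of q] by (auto simp: x_def word_level_def len Suc_diff_le)
    show "x (Suc k) (Suc q) \<le> x k q"
      using nth[of "Suc q"] nth(1)[of M] by (auto simp: x_def word_level_def len)
  qed
  have lev: "word_level w v = word_level w n" if "n \<le> v" for v
    using nth(2) that order_trans[OF nth(2) that] by (auto simp: word_level_def len fun_eq_iff)
  have "x k = word_level w n" if "M + n \<le> k" for k
    using lev[of "k - M"] that by (simp add: x_def fun_eq_iff)
  moreover have "x (M + v) = word_level w v" for v by (simp add: x_def fun_eq_iff)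
  ultimately have "lift_pattern n w x" using gx by (simp add: lift_pattern_def M_def)
  then show ?thesis by blast
qed

lemma lift_pattern_of_lift:
  assumes w: "w \<in> words n" "w \<noteq> []" and "S \<in> lifts n w"
  shows "\<exists>x. has_pattern S x \<and> lift_pattern n w x"
proof -
  define M where "M = length w - 1"
  have len: "length w = Suc M" using w(2) by (cases w) (auto simp: M_def)
  have S: "ssyt (diagram (staircase (length w))) S" and ran: "ran S \<subseteq> {1..M + n}"
    and res: "restrict_entries (Suc M) (M + n) S = word_tableau w"
    using assms(3) by (auto simp: lifts_def Let_def len)
  obtain x where x: "has_pattern S x"
    and full: "\<And>k q. (\<forall>v\<in>ran S. v \<le> k) \<Longrightarrow> x k q = int (length w - q)"
    using ex_has_pattern[OF S] by blast
  note gx = has_patternD(1)[OF x] and D = has_patternD(2)[OF x]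
  have top: "x k q = int (length w - q)" if "M + n \<le> k" for k q
    using ran that by (intro full) auto
  have dom: "dom S = diagram (staircase (length w))" using S by (simp add: ssyt_def)
  have "x (M + v) q = word_level w v q" if v: "v \<le> n" for v q
  proof (cases "q < length w")
    case False
    have "x (M + v) q \<le> x (M + n) q" using v by (intro gt_pattern_mono[OF gx]) simp
    then show ?thesis using False top[of "M + n" q] gt_pattern_nonneg[OF gx, of "M + v" q]
      by (simp add: word_level_def)
  next
    case True
    define c where "c = M - q"
    have qc: "q + c = M" using True by (simp add: c_def len)
    have "restrict_entries (Suc M) (M + n) S (q, c) = Some (w ! c)"
      using res qc by (simp add: word_tableau_def len)
    then have "S (q, c) = Some (M + w ! c)"
      by (auto simp: restrict_entries_def split: option.splits if_splits)
    then have y: "x (M + w ! c - 1) q \<le> int c" "int c < x (M + w ! c) q"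
      by (auto simp: D)
    have "1 \<le> w ! c" using words_nth[OF w(1), of c] qc len by simp
    have "int c < x (M + v) q \<longleftrightarrow> w ! c \<le> v"
    proof
      assume "w ! c \<le> v"
      then show "int c < x (M + v) q"
        using y(2) gt_pattern_mono[OF gx, of "M + w ! c" "M + v" q] by simp
    next
      assume "int c < x (M + v) q"
      moreover have "x (M + v) q \<le> x (M + w ! c - 1) q" if "\<not> w ! c \<le> v"
        using that by (intro gt_pattern_mono[OF gx]) simp
      ultimately show "w ! c \<le> v" using y(1) by linarith
    qed
    moreover have "x (M + v) q \<le> int c + 1"
      using gt_pattern_mono[OF gx, of "M + v" "M + n" q] top[of "M + n" q] v qc len by simp
    moreover have "int c \<le> x (M + v) q"
    proof (cases c)
      case 0
      then show ?thesis using gt_pattern_nonneg[OF gx] by simp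
    next
      case (Suc d)
      have "(q, d) \<in> dom S" using qc Suc by (simp add: dom mem_diagram_staircase len)
      then obtain y where y: "S (q, d) = Some y" by auto
      \<comment> \<open>The left neighbour of the strip box lies in the smaller staircase, so its
        entry is at most \<open>M\<close> and counts at every level from \<open>M\<close>
        on.\<close>
      have "restrict_entries (Suc M) (M + n) S (q, d) = None"
        using res qc Suc by (simp add: word_tableau_def len)
      moreover have "y \<in> ran S" using y by (rule ranI)
      then have "y \<le> M + n" using ran by auto
      ultimately have "y \<le> M" using y by (auto simp: restrict_entries_def split: if_splits)
      then show ?thesis
        using y D[of q d y] gt_pattern_mono[OF gx, of y "M + v" q] Suc by simp
    qed
    ultimately show ?thesis using True by (auto simp: word_level_def len c_def)
  qed
  moreover from this have "x k = word_level w n" if "M + n \<le> k" for k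
    using top[OF that] top[of "M + n"] by (metis ext le_refl)
  ultimately have "lift_pattern n w x"
    using gx by (auto simp: lift_pattern_def M_def fun_eq_iff)
  then show ?thesis using x by blast
qed

lemma restrict_entries_lift_pattern:
  assumes w: "w \<in> words n" "w \<noteq> []" and T: "has_pattern T x" and x: "lift_pattern n w x"
  shows "restrict_entries (length w) (length w - 1 + n) T = word_tableau w"
proof -
  define M where "M = length w - 1"
  have len: "length w = Suc M" using w(2) by (cases w) (auto simp: M_def)
  have lev: "x (M + v) = word_level w v" if "v \<le> n" for v
    using x that by (simp add: lift_pattern_def M_def)
  have "restrict_entries (Suc M) (M + n) T (q, c) = Some v \<longleftrightarrow> word_tableau w (q, c) = Some v" for q c v
  proof -
    have "restrict_entries (Suc M) (M + n) T (q, c) = Some v \<longleftrightarrow>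
        1 \<le> v \<and> v \<le> n \<and> T (q, c) = Some (M + v)"
      by (auto simp: restrict_entries_def split: option.split if_splits)
    also have "\<dots> \<longleftrightarrow> 1 \<le> v \<and> v \<le> n \<and> word_level w (v - 1) q \<le> int c \<and> int c < word_level w v q"
      using lev[of v] lev[of "v - 1"] by (auto simp: has_patternD(2)[OF T])
    also have "\<dots> \<longleftrightarrow> q + c = M \<and> w ! c = v"
    proof (cases "q + c = M")
      case True
      then have "M - q = c" "q \<le> M" by auto
      then show ?thesis using words_nth[OF w(1), of c] True by (auto simp: word_level_def len)
    qed (auto simp: word_level_def len split: if_splits)
    also have "\<dots> \<longleftrightarrow> word_tableau w (q, c) = Some v"
      by (auto simp: word_tableau_def len)
    finally show ?thesis .
  qed
  then have "restrict_entries (Suc M) (M + n) T (q, c) = word_tableau w (q, c)" for q c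
    by (metis not_None_eq)
  then show ?thesis by (auto simp: len)
qed

lemma lift_of_lift_pattern:
  assumes w: "w \<in> words n" "w \<noteq> []" and T: "has_pattern T x" and x: "lift_pattern n w x"
  shows "T \<in> lifts n w"
proof -
  define M where "M = length w - 1"
  have len: "length w = Suc M" using w(2) by (cases w) (auto simp: M_def)
  have gx: "gt_pattern x" and top: "\<And>k. M + n \<le> k \<Longrightarrow> x k = word_level w n"
    using x by (auto simp: lift_pattern_def M_def)
  note D = has_patternD(2)[OF T]
  have lev: "x (M + n) q = int (length w - q)" for q
    using words_nth[OF w(1), of "M - q"] by (auto simp: top word_level_def len)
  have le: "k \<le> M + n" if "T (q, c) = Some k" for q c k
  proof (rule ccontr)
    assume "\<not> k \<le> M + n"
    then have "x k q = x (k - 1) q"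
      using top[of k] top[of "k - 1"] by simp
    then show False using that by (auto simp: D)
  qed
  have "(q, c) \<in> dom T \<longleftrightarrow> q + c < length w" for q c
  proof
    assume "(q, c) \<in> dom T"
    then obtain k where k: "T (q, c) = Some k" by auto
    then have "int c < x (M + n) q"
      using gt_pattern_mono[OF gx le[OF k], of q] by (simp add: D)
    then show "q + c < length w" by (simp add: lev)
  next
    assume "q + c < length w"
    then have ex: "\<exists>k. int c < x k q" by (intro exI[of _ "M + n"]) (simp add: lev)
    define k where "k = (LEAST k. int c < x k q)"
    have k: "int c < x k q" unfolding k_def using ex by (rule LeastI_ex)
    then have "k \<noteq> 0" using gt_patternD(1)[OF gx] by (cases k) auto
    moreover have "\<not> int c < x (k - 1) q"
      using not_less_Least[of "k - 1" "\<lambda>k. int c < x k q"] k_def \<open>k \<noteq> 0\<close> by simp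
    ultimately have "T (q, c) = Some k" using k by (simp add: D)
    then show "(q, c) \<in> dom T" by blast
  qed
  then have dom: "dom T = diagram (staircase (length w))"
    using mem_diagram_staircase by (intro set_eqI) (metis surj_pair)
  have row: "k \<le> k'" if "c < c'" "T (q, c) = Some k" "T (q, c') = Some k'" for q c c' k k'
  proof (rule ccontr)
    assume "\<not> k \<le> k'"
    then have "x k' q \<le> x (k - 1) q" by (intro gt_pattern_mono[OF gx]) simp
    then show False using that by (auto simp: D)
  qed
  have shift: "x (k + (q' - q)) q' \<le> x k q" if "q \<le> q'" for k q q'
    using that
  proof (induction q' rule: dec_induct)
    case (step p)
    then show ?case using gt_patternD(3)[OF gx, of "k + (p - q)" p] by (simp add: Suc_diff_le)
  qed simp
  have col: "k < k'" if "q < q'" "T (q, c) = Some k" "T (q', c) = Some k'" for q q' c k k'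
  proof (rule ccontr)
    assume "\<not> k < k'"
    then have "x k' q' \<le> x (k - 1 + (q' - q)) q'"
      using that(1,3) by (intro gt_pattern_mono[OF gx]) auto
    then show False using shift[of q q' "k - 1"] that by (auto simp: D)
  qed
  have pos: "1 \<le> k" if "T (q, c) = Some k" for q c k
    using that by (simp add: D)
  have "ssyt (diagram (staircase (length w))) T"
    unfolding ssyt_def
  proof (intro conjI ballI allI impI)
    show "1 \<le> k" if "k \<in> ran T" for k using that pos by (auto simp: ran_def)
  qed (use dom row col in blast)+
  moreover have "ran T \<subseteq> {1..M + n}"
    using pos le by (auto simp: ran_def)
  ultimately show ?thesis
    using restrict_entries_lift_pattern[OF assms] by (simp add: lifts_def Let_def M_def)
qed

text \<open>Between the two staircases every row gains exactly one box; the level at which it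
  appears, counted from \<open>length w - 1\<close>, is the letter.\<close>

lemma ex_word_of_pattern:
  assumes w: "w \<in> words n" "w \<noteq> []" and "lift_pattern n w x" and y: "gt_pattern y"
    and bot: "y (length w - 1) = x (length w - 1)"
    and top: "\<And>k. length w - 1 + n \<le> k \<Longrightarrow> y k = x k"
  shows "\<exists>w'. w' \<in> words n \<and> length w' = length w \<and> lift_pattern n w' y"
proof -
  define M where "M = length w - 1"
  have len: "length w = Suc M" using w(2) by (cases w) (auto simp: M_def)
  have nth: "c \<le> M \<Longrightarrow> 1 \<le> w ! c \<and> w ! c \<le> n" for c
    using words_nth[OF w(1), of c] len by auto
  have "y M = word_level w 0"
    using assms(3) bot by (auto simp: lift_pattern_def M_def)
  then have M: "y M q = int (M - q)" for q
    using nth[of "M - q"] by (auto simp: word_level_def len)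
  have "y (M + n) = word_level w n"
    using assms(3) top by (auto simp: lift_pattern_def M_def)
  then have N: "y (M + n) q = int (Suc M - q)" for q
    using nth[of "M - q"] by (auto simp: word_level_def len)
  define f where "f c = (LEAST v. int c < y (M + v) (M - c))" for c
  have f: "int c < y (M + v) (M - c) \<longleftrightarrow> f c \<le> v" if "c \<le> M" for c v
  proof
    assume "int c < y (M + v) (M - c)"
    then show "f c \<le> v" unfolding f_def by (rule Least_le)
  next
    assume v: "f c \<le> v"
    have "int c < y (M + n) (M - c)" using that by (simp add: N)
    then have "int c < y (M + f c) (M - c)" unfolding f_def by (rule LeastI)
    then show "int c < y (M + v) (M - c)"
      using gt_pattern_mono[OF y, of "M + f c" "M + v" "M - c"] v by simp
  qed
  define w' where "w' = map f [0..<Suc M]"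
  have len': "length w' = Suc M" and nth': "c \<le> M \<Longrightarrow> w' ! c = f c" for c
    by (auto simp: w'_def simp del: upt_Suc)
  have "1 \<le> f c \<and> f c \<le> n" if "c \<le> M" for c
    using f[OF that, of 0] f[OF that, of n] that by (auto simp: M N)
  then have words: "w' \<in> words n" by (auto simp: w'_def words_def)
  have "y (M + v) q = word_level w' v q" if v: "v \<le> n" for v q
  proof (cases "q \<le> M")
    case True
    then have "M - (M - q) = q" by simp
    moreover have "y (M + v) q \<le> int (M - q) + 1" "int (M - q) \<le> y (M + v) q"
      using gt_pattern_mono[OF y, of "M + v" "M + n" q] gt_pattern_mono[OF y, of M "M + v" q]
        v True by (auto simp: M N)
    ultimately show ?thesis
      using f[of "M - q" v] True nth'[of "M - q"] by (auto simp: word_level_def len')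
  next
    case False
    then show ?thesis
      using gt_pattern_mono[OF y, of "M + v" "M + n" q] gt_pattern_nonneg[OF y, of "M + v" q] v
      by (simp add: word_level_def len' N)
  qed
  moreover from this have "y k = word_level w' n" if "M + n \<le> k" for k
    using top[of k] top[of "M + n"] that assms(3) unfolding lift_pattern_def M_def[symmetric]
    by (metis ext le_refl)
  ultimately have "lift_pattern n w' y"
    using y by (auto simp: lift_pattern_def len' fun_eq_iff)
  then show ?thesis using words len len' by auto
qed

lemma lift_pattern_unique:
  assumes "w \<in> words n" "w' \<in> words n" "length w = length w'" "w \<noteq> []"
    "lift_pattern n w x" "lift_pattern n w' x"
  shows "w = w'"
proof -
  obtain T where T: "has_pattern T x"
    using ex_tableau[of x] assms(5) unfolding lift_pattern_def by blast
  have "w' \<noteq> []" using assms(3,4) by auto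
  then have "word_tableau w = word_tableau w'"
    using restrict_entries_lift_pattern[OF _ _ T] assms by metis
  then show ?thesis using word_tableau_inject assms(3) by blast
qed

text \<open>Two lifts agree from level \<open>length w - 1\<close> on, and the band starts there or
  later. By locality their images agree on these levels too, so they give the same word.\<close>

lemma tau_lift_pattern:
  assumes w: "w \<in> words n" "w \<noteq> []" and ij: "1 \<le> i" "i < j" "j \<le> n" and x: "lift_pattern n w x"
  shows "tau n i j w \<in> words n \<and> length (tau n i j w) = length w \<and>
    lift_pattern n (tau n i j w) (band_evac (length w - 1 + (i - 1)) (j - i + 1) x)"
proof -
  let ?M = "length w - 1" and ?u = "j - i + 1"
  let ?b = "?M + (i - 1)"
  have len: "length w = Suc ?M" using w(2) by (cases w) auto
  have b: "length w + i - 2 = ?b" using ij len by simp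
  have gx: "gt_pattern x" using x by (simp add: lift_pattern_def)
  have gy: "gt_pattern (band_evac ?b ?u x)" using gx by (rule gt_pattern_band_evac)
  obtain w' where w': "w' \<in> words n" "length w' = length w" "lift_pattern n w' (band_evac ?b ?u x)"
    using ex_word_of_pattern[OF w x gy] band_evac_other[OF gx] ij by auto
  have w'0: "w' \<noteq> []" using w'(2) w(2) by auto
  let ?op = "rect_op ?u ?b \<circ> evac ?u \<circ> rect_op ?b ?u"
  have op: "restrict_entries (length w) (?M + n) (?op S) = word_tableau w'" if S: "S \<in> lifts n w" for S
  proof -
    obtain z where z: "has_pattern S z" "lift_pattern n w z"
      using lift_pattern_of_lift[OF w S] by blast
    have gz: "gt_pattern z" using z by (simp add: lift_pattern_def)
    have lv: "z (?M + v) = x (?M + v)" if "v \<le> n" for v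
      using x z(2) that by (simp add: lift_pattern_def)
    have eq: "z k = x k" if "?M \<le> k" for k
    proof (cases "k \<le> ?M + n")
      case True
      then show ?thesis using lv[of "k - ?M"] that by simp
    next
      case False
      then show ?thesis using x z(2) by (simp add: lift_pattern_def)
    qed
    have ag: "agree {?b..?b + ?u} (band_evac ?b ?u x) (band_evac ?b ?u z)"
      using eq by (intro band_evac_agree[OF gx gz]) (auto simp: agree_def)
    have "band_evac ?b ?u z k = band_evac ?b ?u x k" if "?M \<le> k" for k
      using ag eq[OF that] band_evac_other[OF gx, of k ?b ?u] band_evac_other[OF gz, of k ?b ?u]
      by (cases "?b \<le> k \<and> k \<le> ?b + ?u") (auto simp: agree_def)
    then have "lift_pattern n w' (band_evac ?b ?u z)"
      using w'(2,3) gt_pattern_band_evac[OF gz] by (auto simp: lift_pattern_def)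
    then show ?thesis
      using restrict_entries_lift_pattern[OF w'(1) w'0 has_pattern_band_evac[OF z(1)]] w'(2)
      by simp
  qed
  \<comment> \<open>A lift exists, so the universally quantified condition in \<open>tau\<close> is
    not vacuous and pins the word down.\<close>
  obtain T where "has_pattern T x" using ex_tableau[OF gx] by blast
  then have T: "T \<in> lifts n w" using lift_of_lift_pattern[OF w _ x] by blast
  have "tau n i j w = w'"
    unfolding tau_def Let_def b using w(2)
  proof (simp only: if_False, intro the_equality conjI ballI)
    fix w2 assume w2: "w2 \<in> words n \<and> length w2 = length w \<and>
      (\<forall>S\<in>lifts n w. restrict_entries (length w) (?M + n) (?op S) = word_tableau w2)"
    then show "w2 = w'" using op[OF T] T w'(2) word_tableau_inject by metis
  qed (use w' op in auto)
  then show ?thesis using w' by simp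
qed

section \<open>The cactus relations\<close>

lemma tau_Nil: "tau n i j [] = []"
  by (simp add: tau_def)

lemma tau_words:
  assumes "w \<in> words n" "1 \<le> i" "i < j" "j \<le> n" shows "tau n i j w \<in> words n"
proof (cases "w = []")
  case False
  then show ?thesis using ex_lift_pattern tau_lift_pattern assms by meson
qed (use assms in \<open>simp add: tau_Nil\<close>)

text \<open>As in the next two relations, both sides are words lifted by one and the same pattern,
  so the identity for \<open>band_evac\<close> yields the identity of words by
  \<open>lift_pattern_unique\<close>.\<close>

lemma tau_tau:
  assumes w: "w \<in> words n" and ij: "1 \<le> i" "i < j" "j \<le> n"
  shows "tau n i j (tau n i j w) = w"
proof (cases "w = []")
  case False
  obtain x where x: "lift_pattern n w x" using ex_lift_pattern[OF w False] by blast
  note 1 = tau_lift_pattern[OF w False ij x]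
  let ?w = "tau n i j w"
  have "?w \<noteq> []" using 1 False by auto
  note 2 = tau_lift_pattern[OF conjunct1[OF 1] this ij conjunct2[OF conjunct2[OF 1]]]
  show ?thesis
    using 1 2 x by (intro lift_pattern_unique[OF _ w _ _ _ x]) (auto simp: False)
qed (simp add: tau_Nil)

lemma tau_commute:
  assumes w: "w \<in> words n" and ij: "1 \<le> i" "i < j" "j < k" "k < l" "l \<le> n"
  shows "tau n i j (tau n k l w) = tau n k l (tau n i j w)"
proof (cases "w = []")
  case False
  have ij': "1 \<le> i" "i < j" "j \<le> n" and kl: "1 \<le> k" "k < l" "l \<le> n" using ij by auto
  obtain x where x: "lift_pattern n w x" using ex_lift_pattern[OF w False] by blast
  then have gx: "gt_pattern x" by (simp add: lift_pattern_def)
  note a = tau_lift_pattern[OF w False ij' x] and b = tau_lift_pattern[OF w False kl x]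
  have ne: "tau n i j w \<noteq> []" "tau n k l w \<noteq> []" using a b False by auto
  note a2 = tau_lift_pattern[OF conjunct1[OF a] ne(1) kl conjunct2[OF conjunct2[OF a]]]
  note b2 = tau_lift_pattern[OF conjunct1[OF b] ne(2) ij' conjunct2[OF conjunct2[OF b]]]
  let ?M = "length w - 1"
  have "band_evac (?M + (i - 1)) (j - i + 1) (band_evac (?M + (k - 1)) (l - k + 1) x) =
      band_evac (?M + (k - 1)) (l - k + 1) (band_evac (?M + (i - 1)) (j - i + 1) x)"
    using ij by (intro band_evac_commute[OF gx]) auto
  then show ?thesis
    using a b a2 b2 False by (intro lift_pattern_unique[of _ n _ "band_evac (?M + (k - 1)) (l - k + 1)
      (band_evac (?M + (i - 1)) (j - i + 1) x)"]) auto
qed (simp add: tau_Nil)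

lemma tau_conjugate:
  assumes w: "w \<in> words n" and ij: "1 \<le> i" "i \<le> j" "j < k" "k \<le> l" "l \<le> n"
  shows "tau n i l (tau n j k (tau n i l w)) = tau n (i + l - k) (i + l - j) w"
proof (cases "w = []")
  case False
  have il: "1 \<le> i" "i < l" "l \<le> n" and jk: "1 \<le> j" "j < k" "k \<le> n"
    and ijkl: "1 \<le> i + l - k" "i + l - k < i + l - j" "i + l - j \<le> n"
    using ij by auto
  obtain x where x: "lift_pattern n w x" using ex_lift_pattern[OF w False] by blast
  then have gx: "gt_pattern x" by (simp add: lift_pattern_def)
  note 1 = tau_lift_pattern[OF w False il x]
  have ne1: "tau n i l w \<noteq> []" using 1 False by auto
  note 2 = tau_lift_pattern[OF conjunct1[OF 1] ne1 jk conjunct2[OF conjunct2[OF 1]]]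
  have ne2: "tau n j k (tau n i l w) \<noteq> []" using 2 ne1 by auto
  note 3 = tau_lift_pattern[OF conjunct1[OF 2] ne2 il conjunct2[OF conjunct2[OF 2]]]
  note 4 = tau_lift_pattern[OF w False ijkl x]
  \<comment> \<open>Inside the interval from \<open>i\<close> to \<open>l\<close>, the band from
    \<open>j\<close> to \<open>k\<close> has \<open>?d\<close> letters before it and
    \<open>?c\<close> after it; reversal exchanges these numbers.\<close>
  let ?a = "length w - 1 + (i - 1)" and ?c = "l - k" and ?d = "j - i" and ?u = "k - j + 1"
  have idx: "l - i + 1 = ?c + ?d + ?u" "length w - 1 + (j - 1) = ?a + ?d"
      "length w - 1 + (i + l - k - 1) = ?a + ?c" "i + l - j - (i + l - k) + 1 = ?u"
    using ij by auto
  have "band_evac ?a (l - i + 1) (band_evac (length w - 1 + (j - 1)) ?u (band_evac ?a (l - i + 1) x)) =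
      band_evac (length w - 1 + (i + l - k - 1)) (i + l - j - (i + l - k) + 1) x"
    unfolding idx by (rule band_evac_conjugate[OF gx])
  then show ?thesis
    using 1 2 3 4 ne2 by (intro lift_pattern_unique[of _ n _
      "band_evac (length w - 1 + (i + l - k - 1)) (i + l - j - (i + l - k) + 1) x"]) auto
qed (simp add: tau_Nil)

theorem corollary1p5:
  fixes n :: nat
  assumes "n \<ge> 2"
  shows "(\<forall>i j. 1 \<le> i \<and> i < j \<and> j \<le> n \<longrightarrow> tau n i j \<in> words n \<rightarrow> words n)
    \<and> (\<forall>i j. 1 \<le> i \<and> i < j \<and> j \<le> n \<longrightarrow>
         (\<forall>w\<in>words n. (tau n i j \<circ> tau n i j) w = w))
    \<and> (\<forall>i j k l. 1 \<le> i \<and> i < j \<and> j < k \<and> k < l \<and> l \<le> n \<longrightarrow>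
         (\<forall>w\<in>words n. (tau n i j \<circ> tau n k l) w = (tau n k l \<circ> tau n i j) w))
    \<and> (\<forall>i j k l. 1 \<le> i \<and> i \<le> j \<and> j < k \<and> k \<le> l \<and> l \<le> n \<longrightarrow>
         (\<forall>w\<in>words n. (tau n i l \<circ> tau n j k \<circ> tau n i l) w
                        = tau n (i + l - k) (i + l - j) w))"
  unfolding Pi_iff o_apply using tau_words tau_tau tau_commute tau_conjugate by blast

end
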